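(* Suppose that $f:\mathbb{R}^d\to\mathbb{R}$ is convex and twice continuously differentiable with a minimizer $x^*$, that the symmetric Hessian approximation satisfies $\|H(x)-\nabla^2 f(x)\|\le\delta$ for all $x$, and that $f$ satisfies either the global or the local generalized Hessian smoothness condition (with constants $M_0,M_1\ge0$, and radius $\rho>0$ in the local case). Assume $R=\|x_0-x^*\|>0$ and set $$B=\max\{1,8\sqrt{M_1}R,8R/\rho\},\qquad \varepsilon_{\rm tr}=\max\{20M_0R^3/B^3,\ 4\delta R^2/B^2\}.$$ There are universal constants $C,c>0$ such that the following hold for the adaptive A-NPE method started from $x_0$ with any input $\tau_0>0$ (with $A_1$ the first weight of the method). For every $\varepsilon>0$, the method generates an iterate $w_N$ satisfying $f(w_N)-f^*\le\varepsilon$ within $$N\le C\left(B\Big(1+\log_+\frac{R^2}{2A_1\max\{\varepsilon,\varepsilon_{\rm tr}\}}\Big)+\Big(\frac{M_0R^3}{\varepsilon}\Big)^{1/3}+\sqrt{\frac{\delta R^2}{\varepsilon}}\right)$$ iterations, and the number of rejected trials before producing $w_N$ is at most $$\left\lceil\log_2\max\Big\{1,\frac{4\delta}{\tau_0},\frac{2\sqrt{L(x_0)\|\nabla f(x_0)\|}}{\tau_0},\frac{2\|\nabla f(x_0)\|}{\rho\tau_0}\Big\}\right\rceil+\left\lceil\log_2\max\Big\{B^2,\frac{4\delta R^2}{\varepsilon},\Big(\frac{20M_0R^3}{\varepsilon}\Big)^{2/3}\Big\}\right\rceil.$$ Moreover, there exists an integer $K\ge1$ with $K\le C\,B\max\big\{1,\log\frac{R^2}{2A_1\varepsilon_{\rm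 tr}}\big\}$ such that $$f(w_k)-f^*\le C\frac{R^2}{A_1}\exp\Big(-\frac{c(k-1)}{B}\Big),\qquad1\le k\le K,$$ $$f(w_{K+n})-f^*\le C\left(\frac{M_0R^3}{(B+n)^3}+\frac{\delta R^2}{(B+n)^2}\right),\qquad n=0,1,\ldots.$$
   Context: $\|\cdot\|$ is the Euclidean norm for vectors and the induced operator norm for matrices; $f^*=f(x^* )$; $\log_+t=\max\{0,\log t\}$. Conventions: $a/(+\infty)=0$ for finite $a\ge0$ and $a/0=+\infty$ for $a>0$. Put $L(x)=M_0+M_1\|\nabla f(x)\|$. If $\varepsilon_{\rm tr}=0$, then $K=+\infty$ is allowed and the last bound is void. Global generalized Hessian smoothness: $\|\nabla^2f(y)-\nabla^2f(x)\|\le L(x)\|y-x\|$ for all $x,y\in\mathbb{R}^d$; in this case set $\rho=+\infty$. Local generalized Hessian smoothness with radius $\rho>0$: the same inequality for all $x,y$ with $\|y-x\|\le\rho$. Procedure $\mathrm{MSBacktrack}(x,\tau)$: repeat the following trial. If $H(x)+\tau I\succ0$, solve $(H(x)+\tau I)s=-\nabla f(x)$; if moreover $\|\nabla f(x+s)+\tau s\|\le\frac{\tau}{2}\|s\|$, return the pair $(x+s,\tau)$. Otherwise (trial rejected) replace $\tau$ by $2\tau$. Adaptive A-NPE method. Input $x_0\in\mathbb{R}^d$, $\tau_0>0$. Initialization: $(w_1,\tau_1)=\mathrm{MSBacktrack}(x_0,\tau_0)$, $A_1=1/\tau_1$, $z_1=x_0-A_1\nabla f(w_1)$. For $k\ge1$,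 starting from the current value of $\tau_k$, perform trials as follows: set $$\alpha_k=\frac{2}{1+\sqrt{1+4A_k\tau_k}},\quad A_{k+1}=\frac{A_k}{1-\alpha_k},\quad a_{k+1}=\alpha_kA_{k+1},\quad v_k=(1-\alpha_k)w_k+\alpha_kz_k;$$ if $H(w_k)+\tau_kI\succ0$, let $s_k$ solve $(H(w_k)+\tau_kI)s_k=-\nabla f(v_k)$ and set $w_{k+1}=v_k+s_k$. The trial is accepted if $H(w_k)+\tau_kI\succ0$ and $\|\nabla f(v_k+s_k)+\tau_ks_k\|\le\frac{\tau_k}{2}\|s_k\|$; otherwise it is rejected, $\tau_k$ is replaced by $2\tau_k$, and all these quantities are recomputed (with $w_k,z_k,A_k,H(w_k)$ fixed). After acceptance set $z_{k+1}=z_k-a_{k+1}\nabla f(w_{k+1})$ and let the first trial value at iteration $k+1$ be $\tau_{k+1}=(1-\alpha_k)\tau_k$. *)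

theory Defs
  imports "HOL-Analysis.Analysis"
begin

text \<open>The constants in the result are universal, in particular independent of the dimension \<open>d\<close>,
  so \<open>d\<close> has to be quantified inside the statement and cannot be a type. All the spaces
  \<open>\<real>\<^sup>d\<close> are therefore realised inside one inner product space, the finitely supported real
  sequences, as the subspaces of sequences vanishing from index \<open>d\<close> on.\<close>

typedef rvec = "{x :: nat \<Rightarrow> real. finite {i. x i \<noteq> 0}}"
  morphisms coord mk_rvec
  by (rule exI[of _ "\<lambda>_. 0"]) simp

setup_lifting type_definition_rvec

lemma finite_coord: "finite {i. coord x i \<noteq> 0}"
  using coord[of x] by simp

lemma rvec_eqI: "(\<And>i. coord x i = coord y i) \<Longrightarrow> x = y"
  by (simp add: coord_inject[symmetric] fun_eq_iff)

instantiation rvec :: real_vector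
begin

lift_definition zero_rvec :: rvec is "\<lambda>_. 0" by simp

lift_definition plus_rvec :: "rvec \<Rightarrow> rvec \<Rightarrow> rvec" is "\<lambda>x y i. x i + y i"
proof -
  fix x y :: "nat \<Rightarrow> real"
  assume "finite {i. x i \<noteq> 0}" "finite {i. y i \<noteq> 0}"
  then show "finite {i. x i + y i \<noteq> 0}"
    by (rule_tac finite_subset[of _ "{i. x i \<noteq> 0} \<union> {i. y i \<noteq> 0}"]) auto
qed

lift_definition uminus_rvec :: "rvec \<Rightarrow> rvec" is "\<lambda>x i. - x i" by simp

lift_definition minus_rvec :: "rvec \<Rightarrow> rvec \<Rightarrow> rvec" is "\<lambda>x y i. x i - y i"
proof -
  fix x y :: "nat \<Rightarrow> real"
  assume "finite {i. x i \<noteq> 0}" "finite {i. y i \<noteq> 0}"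
  then show "finite {i. x i - y i \<noteq> 0}"
    by (rule_tac finite_subset[of _ "{i. x i \<noteq> 0} \<union> {i. y i \<noteq> 0}"]) auto
qed

lift_definition scaleR_rvec :: "real \<Rightarrow> rvec \<Rightarrow> rvec" is "\<lambda>c x i. c * x i"
  by (erule rev_finite_subset) auto

instance
  by standard (transfer; simp add: algebra_simps)+

end

lemma coord_simps [simp]:
  "coord 0 i = 0" "coord (x + y) i = coord x i + coord y i"
  "coord (- x) i = - coord x i" "coord (x - y) i = coord x i - coord y i"
  "coord (c *\<^sub>R x) i = c * coord x i"
  by (transfer; simp)+

definition rvec_ip :: "rvec \<Rightarrow> rvec \<Rightarrow> real" where
  "rvec_ip x y = (\<Sum>i | coord x i \<noteq> 0. coord x i * coord y i)"

lemma rvec_ip_superset: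
  assumes "finite I" "\<And>i. coord x i \<noteq> 0 \<Longrightarrow> i \<in> I"
  shows "rvec_ip x y = (\<Sum>i\<in>I. coord x i * coord y i)"
  unfolding rvec_ip_def using assms by (intro sum.mono_neutral_left) auto

instantiation rvec :: real_inner
begin

definition "inner_rvec = rvec_ip"
definition "norm_rvec (x :: rvec) = sqrt (inner x x)"
definition "dist_rvec (x :: rvec) y = norm (x - y)"
definition "sgn_rvec (x :: rvec) = x /\<^sub>R norm x"
definition "uniformity_rvec = (INF e\<in>{0<..}. principal {(x :: rvec, y). dist x y < e})"
definition "open_rvec (U :: rvec set) \<longleftrightarrow>
  (\<forall>x\<in>U. eventually (\<lambda>(x', y). x' = x \<longrightarrow> y \<in> U) uniformity)"

instance
proof
  fix x y z :: rvec and r :: real and U :: "rvec set"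
  let ?I = "{i. coord x i \<noteq> 0} \<union> {i. coord y i \<noteq> 0}"
  have fin: "finite ?I" by (simp add: finite_coord)
  have x: "rvec_ip x u = (\<Sum>i\<in>?I. coord x i * coord u i)" for u
    by (rule rvec_ip_superset[OF fin]) auto
  have y: "rvec_ip y u = (\<Sum>i\<in>?I. coord y i * coord u i)" for u
    by (rule rvec_ip_superset[OF fin]) auto
  have xy: "rvec_ip (x + y) u = (\<Sum>i\<in>?I. coord (x + y) i * coord u i)" for u
    by (rule rvec_ip_superset[OF fin]) auto
  have rx: "rvec_ip (r *\<^sub>R x) u = (\<Sum>i\<in>?I. coord (r *\<^sub>R x) i * coord u i)" for u
    by (rule rvec_ip_superset[OF fin]) auto
  show "inner x y = inner y x"
    unfolding inner_rvec_def x y by (simp add: mult.commute)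
  show "inner (x + y) z = inner x z + inner y z"
    unfolding inner_rvec_def x y xy by (simp add: algebra_simps sum.distrib)
  show "inner (r *\<^sub>R x) y = r * inner x y"
    unfolding inner_rvec_def x rx by (simp add: algebra_simps sum_distrib_left)
  show "0 \<le> inner x x"
    unfolding inner_rvec_def rvec_ip_def by (intro sum_nonneg) simp
  show "inner x x = 0 \<longleftrightarrow> x = 0"
  proof
    assume "inner x x = 0"
    then have "\<forall>i\<in>{i. coord x i \<noteq> 0}. coord x i * coord x i = 0"
      unfolding inner_rvec_def rvec_ip_def
      by (subst (asm) sum_nonneg_eq_0_iff) (auto simp: finite_coord)
    then show "x = 0" by (intro rvec_eqI) auto
  qed (simp add: inner_rvec_def rvec_ip_def)
qed (rule norm_rvec_def dist_rvec_def sgn_rvec_def uniformity_rvec_def open_rvec_def)+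

end

definition Rd :: "nat \<Rightarrow> rvec set" where
  "Rd d = {x. \<forall>i\<ge>d. coord x i = 0}"

lemma inner_Rd: "x \<in> Rd d \<Longrightarrow> inner x y = (\<Sum>i<d. coord x i * coord y i)"
  unfolding inner_rvec_def by (rule rvec_ip_superset) (auto simp: Rd_def not_less[symmetric])

lemma subspace_Rd: "subspace (Rd d)"
  by (auto simp: subspace_def Rd_def)

lemma Rd_exhaust: "\<exists>!x\<in>Rd d. \<forall>i<d. coord x i = a i"
proof -
  have fin: "finite {i. (if i < d then a i else 0) \<noteq> 0}"
    by (rule finite_subset[of _ "{..<d}"]) auto
  define u where "u = mk_rvec (\<lambda>i. if i < d then a i else 0)"
  have u: "coord u i = (if i < d then a i else 0)" for i
    unfolding u_def using fin by (simp add: mk_rvec_inverse)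
  show ?thesis
  proof (rule ex1I[of _ u])
    show "u \<in> Rd d \<and> (\<forall>i<d. coord u i = a i)"
      by (simp add: Rd_def u)
    show "y = u" if "y \<in> Rd d \<and> (\<forall>i<d. coord y i = a i)" for y
      using that by (intro rvec_eqI) (simp add: Rd_def u)
  qed
qed

text \<open>A \<open>d \<times> d\<close> matrix is a bounded operator mapping into \<open>\<real>\<^sup>d\<close> and
  vanishing on its orthogonal complement. With this normalisation, the operator \<^const>\<open>norm\<close> on
  the ambient space is the operator norm induced by the Euclidean norm of \<open>\<real>\<^sup>d\<close>.\<close>

definition mats :: "nat \<Rightarrow> (rvec \<Rightarrow>\<^sub>L rvec) set" where
  "mats d = {A. (\<forall>v. blinfun_apply A v \<in> Rd d) \<and>
                (\<forall>v. (\<forall>i<d. coord v i = 0) \<longrightarrow> blinfun_apply A v = 0)}"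

lemma norm_mats_le_iff:
  assumes "A \<in> mats d" "b \<ge> 0"
  shows "norm A \<le> b \<longleftrightarrow> (\<forall>v\<in>Rd d. norm (blinfun_apply A v) \<le> b * norm v)"
proof
  assume "norm A \<le> b"
  then show "\<forall>v\<in>Rd d. norm (blinfun_apply A v) \<le> b * norm v"
    by (meson mult_right_mono norm_blinfun norm_ge_zero order_trans)
next
  assume bd: "\<forall>v\<in>Rd d. norm (blinfun_apply A v) \<le> b * norm v"
  show "norm A \<le> b"
  proof (rule norm_blinfun_bound[OF assms(2)])
    fix v
    obtain u where u: "u \<in> Rd d" "\<And>i. i < d \<Longrightarrow> coord u i = coord v i"
      using Rd_exhaust[of d "coord v"] by auto
    have "blinfun_apply A (v - u) = 0"
      using assms(1) u(2) by (simp add: mats_def)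
    then have Av: "blinfun_apply A v = blinfun_apply A u"
      by (simp add: blinfun.diff_right)
    have "inner u u = inner u v"
      using u by (simp add: inner_Rd)
    then have "norm u * norm u \<le> norm u * norm v"
      using norm_cauchy_schwarz[of u v] by (simp add: power2_norm_eq_inner[symmetric] power2_eq_square)
    then have "norm u \<le> norm v"
      by (cases "u = 0") auto
    then show "norm (blinfun_apply A v) \<le> b * norm v"
      using bd u(1) Av assms(2) by (metis mult_left_mono order_trans)
  qed
qed

definition sym_mats :: "nat \<Rightarrow> (rvec \<Rightarrow>\<^sub>L rvec) set" where
  "sym_mats d = {A \<in> mats d. \<forall>u\<in>Rd d. \<forall>v\<in>Rd d. inner (blinfun_apply A u) v = inner u (blinfun_apply A v)}"

definition pos_def :: "nat \<Rightarrow> (rvec \<Rightarrow>\<^sub>L rvec) \<Rightarrow> bool" where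
  "pos_def d A \<longleftrightarrow> (\<forall>v\<in>Rd d. v \<noteq> 0 \<longrightarrow> inner (blinfun_apply A v) v > 0)"

text \<open>\<open>f\<close> is of class \<open>C\<^sup>2\<close> on \<open>\<real>\<^sup>d\<close>, with gradient \<open>g\<close> and Hessian \<open>D\<close> (both are
  determined by \<open>f\<close> on \<open>\<real>\<^sup>d\<close>). All derivatives are relative to the subspace, so that
  the values of \<open>f\<close> outside \<open>\<real>\<^sup>d\<close> are irrelevant.\<close>

definition C2_on_Rd ::
  "nat \<Rightarrow> (rvec \<Rightarrow> real) \<Rightarrow> (rvec \<Rightarrow> rvec) \<Rightarrow> (rvec \<Rightarrow> (rvec \<Rightarrow>\<^sub>L rvec)) \<Rightarrow> bool" where
  "C2_on_Rd d f g D \<longleftrightarrow>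
     (\<forall>x\<in>Rd d. g x \<in> Rd d \<and> (f has_derivative (\<lambda>h. inner (g x) h)) (at x within Rd d)) \<and>
     (\<forall>x\<in>Rd d. D x \<in> mats d \<and> (g has_derivative blinfun_apply (D x)) (at x within Rd d)) \<and>
     continuous_on (Rd d) D"

definition gen_L :: "(rvec \<Rightarrow> rvec) \<Rightarrow> real \<Rightarrow> real \<Rightarrow> rvec \<Rightarrow> real" where
  "gen_L g M0 M1 x = M0 + M1 * norm (g x)"

definition hess_smooth_global ::
  "nat \<Rightarrow> (rvec \<Rightarrow> rvec) \<Rightarrow> (rvec \<Rightarrow> (rvec \<Rightarrow>\<^sub>L rvec)) \<Rightarrow> real \<Rightarrow> real \<Rightarrow> bool" where
  "hess_smooth_global d g D M0 M1 \<longleftrightarrow>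
     (\<forall>x\<in>Rd d. \<forall>y\<in>Rd d. norm (D y - D x) \<le> gen_L g M0 M1 x * norm (y - x))"

definition hess_smooth_local ::
  "nat \<Rightarrow> (rvec \<Rightarrow> rvec) \<Rightarrow> (rvec \<Rightarrow> (rvec \<Rightarrow>\<^sub>L rvec)) \<Rightarrow> real \<Rightarrow> real \<Rightarrow> real \<Rightarrow> bool" where
  "hess_smooth_local d g D M0 M1 r \<longleftrightarrow>
     (\<forall>x\<in>Rd d. \<forall>y\<in>Rd d. norm (y - x) \<le> r \<longrightarrow>
        norm (D y - D x) \<le> gen_L g M0 M1 x * norm (y - x))"

text \<open>For real \<open>a\<close> and an extended real \<open>r > 0\<close> this is \<open>a / r\<close>, with \<open>a / \<infinity> = 0\<close>.\<close>

definition div_ext :: "real \<Rightarrow> ereal \<Rightarrow> real" where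
  "div_ext a r = real_of_ereal (ereal a / r)"

definition B_const :: "real \<Rightarrow> real \<Rightarrow> ereal \<Rightarrow> real" where
  "B_const M1 R \<rho> = Max {1, 8 * sqrt M1 * R, div_ext (8 * R) \<rho>}"

definition eps_tr :: "real \<Rightarrow> real \<Rightarrow> real \<Rightarrow> real \<Rightarrow> real" where
  "eps_tr M0 \<delta> R B = max (20 * M0 * R ^ 3 / B ^ 3) (4 * \<delta> * R\<^sup>2 / B\<^sup>2)"

definition log_plus :: "real \<Rightarrow> real" where
  "log_plus t = max 0 (ln t)"

text \<open>The trial with regularisation \<open>\<tau>\<close>, base point \<open>v\<close> and Hessian approximation \<open>Q\<close> is accepted
  with step \<open>s\<close>. By positive definiteness the linear system has exactly one solution, so a trial
  is rejected iff this holds for no \<open>s\<close>.\<close>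

definition accepts ::
  "nat \<Rightarrow> (rvec \<Rightarrow> rvec) \<Rightarrow> (rvec \<Rightarrow>\<^sub>L rvec) \<Rightarrow> rvec \<Rightarrow> real \<Rightarrow> rvec \<Rightarrow> bool" where
  "accepts d g Q v \<tau> s \<longleftrightarrow>
     pos_def d (Q + \<tau> *\<^sub>R id_blinfun) \<and>
     s \<in> Rd d \<and> blinfun_apply (Q + \<tau> *\<^sub>R id_blinfun) s = - g v \<and>
     norm (g (v + s) + \<tau> *\<^sub>R s) \<le> \<tau> / 2 * norm s"

text \<open>\<open>MSBacktrack d g H x \<tau> x' \<tau>' j\<close>: the procedure, called with \<open>(x, \<tau>)\<close>, returns \<open>(x', \<tau>')\<close>
  after \<open>j\<close> rejected trials.\<close>

inductive MSBacktrack ::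
  "nat \<Rightarrow> (rvec \<Rightarrow> rvec) \<Rightarrow> (rvec \<Rightarrow> (rvec \<Rightarrow>\<^sub>L rvec)) \<Rightarrow> rvec \<Rightarrow> real \<Rightarrow> rvec \<Rightarrow> real \<Rightarrow> nat \<Rightarrow> bool"
  for d g H x where
  accept: "accepts d g (H x) x \<tau> s \<Longrightarrow> MSBacktrack d g H x \<tau> (x + s) \<tau> 0"
| reject: "\<lbrakk>\<nexists>s. accepts d g (H x) x \<tau> s; MSBacktrack d g H x (2 * \<tau>) x' \<tau>' j\<rbrakk>
    \<Longrightarrow> MSBacktrack d g H x \<tau> x' \<tau>' (Suc j)"

definition npe_alpha :: "real \<Rightarrow> real \<Rightarrow> real" where
  "npe_alpha A \<tau> = 2 / (1 + sqrt (1 + 4 * A * \<tau>))"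

definition npe_v :: "rvec \<Rightarrow> rvec \<Rightarrow> real \<Rightarrow> real \<Rightarrow> rvec" where
  "npe_v w z A \<tau> = (1 - npe_alpha A \<tau>) *\<^sub>R w + npe_alpha A \<tau> *\<^sub>R z"

text \<open>\<open>NPE_step d g H w z A \<tau> w' z' A' \<tau>' j\<close>: one iteration, started from \<open>w, z, A\<close> with first trial
  value \<open>\<tau>\<close>, produces \<open>w', z', A'\<close> and the next first trial value \<open>\<tau>'\<close> after \<open>j\<close> rejected
  trials.\<close>

inductive NPE_step ::
  "nat \<Rightarrow> (rvec \<Rightarrow> rvec) \<Rightarrow> (rvec \<Rightarrow> (rvec \<Rightarrow>\<^sub>L rvec)) \<Rightarrow> rvec \<Rightarrow> rvec \<Rightarrow> real \<Rightarrow> real \<Rightarrow>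
   rvec \<Rightarrow> rvec \<Rightarrow> real \<Rightarrow> real \<Rightarrow> nat \<Rightarrow> bool"
  for d g H w z A where
  accept: "\<lbrakk>accepts d g (H w) (npe_v w z A \<tau>) \<tau> s;
            \<alpha> = npe_alpha A \<tau>; A' = A / (1 - \<alpha>); a' = \<alpha> * A';
            w' = npe_v w z A \<tau> + s; z' = z - a' *\<^sub>R g w'\<rbrakk>
    \<Longrightarrow> NPE_step d g H w z A \<tau> w' z' A' ((1 - \<alpha>) * \<tau>) 0"
| reject: "\<lbrakk>\<nexists>s. accepts d g (H w) (npe_v w z A \<tau>) \<tau> s;
            NPE_step d g H w z A (2 * \<tau>) w' z' A' \<tau>' j\<rbrakk>
    \<Longrightarrow> NPE_step d g H w z A \<tau> w' z' A' \<tau>' (Suc j)"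

text \<open>A run from \<open>x0, \<tau>0\<close>: \<open>\<tau> k\<close> is the first trial value at iteration \<open>k \<ge> 1\<close>; \<open>r 0\<close> counts the
  trials rejected in the initialization and \<open>r k\<close> those rejected in iteration \<open>k\<close>, which produces
  \<open>w (Suc k)\<close>. The values of \<open>w, z, A, \<tau>\<close> at index \<open>0\<close> are not used.\<close>

definition A_NPE_run ::
  "nat \<Rightarrow> (rvec \<Rightarrow> rvec) \<Rightarrow> (rvec \<Rightarrow> (rvec \<Rightarrow>\<^sub>L rvec)) \<Rightarrow> rvec \<Rightarrow> real \<Rightarrow>
   (nat \<Rightarrow> rvec) \<Rightarrow> (nat \<Rightarrow> rvec) \<Rightarrow> (nat \<Rightarrow> real) \<Rightarrow> (nat \<Rightarrow> real) \<Rightarrow> (nat \<Rightarrow> nat) \<Rightarrow> bool" where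
  "A_NPE_run d g H x0 \<tau>0 w z A \<tau> r \<longleftrightarrow>
     MSBacktrack d g H x0 \<tau>0 (w 1) (\<tau> 1) (r 0) \<and>
     A 1 = 1 / \<tau> 1 \<and> z 1 = x0 - A 1 *\<^sub>R g (w 1) \<and>
     (\<forall>k\<ge>1. NPE_step d g H (w k) (z k) (A k) (\<tau> k)
               (w (Suc k)) (z (Suc k)) (A (Suc k)) (\<tau> (Suc k)) (r k))"

definition iteration_bound ::
  "real \<Rightarrow> real \<Rightarrow> real \<Rightarrow> real \<Rightarrow> ereal \<Rightarrow> real \<Rightarrow> real \<Rightarrow> real \<Rightarrow> real" where
  "iteration_bound M0 M1 \<delta> R \<rho> A1 C \<epsilon> =
     (let B = B_const M1 R \<rho> in
      C * (B * (1 + log_plus (R\<^sup>2 / (2 * A1 * max \<epsilon> (eps_tr M0 \<delta> R B))))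
           + (M0 * R ^ 3 / \<epsilon>) powr (1 / 3) + sqrt (\<delta> * R\<^sup>2 / \<epsilon>)))"

definition rejection_bound ::
  "(rvec \<Rightarrow> rvec) \<Rightarrow> rvec \<Rightarrow> real \<Rightarrow> real \<Rightarrow> real \<Rightarrow> real \<Rightarrow> real \<Rightarrow> ereal \<Rightarrow> real \<Rightarrow> int" where
  "rejection_bound g x0 \<tau>0 M0 M1 \<delta> R \<rho> \<epsilon> =
     \<lceil>log 2 (Max {1, 4 * \<delta> / \<tau>0,
                  2 * sqrt (gen_L g M0 M1 x0 * norm (g x0)) / \<tau>0,
                  div_ext (2 * norm (g x0)) (\<rho> * ereal \<tau>0)})\<rceil>
     + \<lceil>log 2 (Max {(B_const M1 R \<rho>)\<^sup>2, 4 * \<delta> * R\<^sup>2 / \<epsilon>, (20 * M0 * R ^ 3 / \<epsilon>) powr (2 / 3)})\<rceil>"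

end

theory Submission
  imports Defs
begin

text \<open>Write \<open>p = A \<tau>\<close> for the product of the current weight and the current regularisation. The choice
  \<open>\<alpha> = 2 / (1 + sqrt (1 + 4 p))\<close> solves \<open>p \<alpha>\<^sup>2 = 1 - \<alpha>\<close> and depends on \<open>p\<close> only. Passing from one iteration
  to the next leaves \<open>p\<close> unchanged, because \<open>A\<close> is divided and \<open>\<tau>\<close> multiplied by \<open>1 - \<alpha>\<close>; a rejected
  trial doubles it, and \<open>p = 1\<close> after the initialization. Hence \<open>p\<close> is \<open>2\<close> to the number of trials
  rejected so far, and everything reduces to one question: for which \<open>p\<close> is a trial certainly accepted?

  The accepted steps satisfy the relative error condition of an inexact proximal point method, so
  that \<open>A (f w - f\<^sup>*) + |z - x\<^sup>*|\<^sup>2 / 2\<close> does not increase, and its decrease controls the length of the step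
  (\<open>accelerated_step_decrease\<close>). Consequences are \<open>f w - f\<^sup>* \<le> R\<^sup>2 / (2 A)\<close>, the bound \<open>O(\<alpha> R)\<close> for accepted
  steps, and a bound \<open>O(R / (\<alpha> A))\<close> for the gradient at \<open>w\<close>, which turns the generalized smoothness constant
  \<open>M0 + M1 |g w|\<close> into something that can be compared with \<open>\<tau>\<close>. What remains is to bound the length of a
  step that has not yet been accepted. The point \<open>(1 - \<alpha>) w + \<alpha> x\<^sup>*\<close> lies within \<open>\<alpha> R\<close> of \<open>v\<close>, and there the
  proximal objective \<open>f + \<tau> / 2 |\<cdot> - v|\<^sup>2\<close> exceeds \<open>f\<^sup>*\<close> by at most \<open>\<tau> (\<alpha> R)\<^sup>2 / 2\<close>; as the quadratic model of this
  objective is accurate on the ball of radius \<open>3 \<alpha> R\<close> and strongly convex, its minimizer \<open>v + s\<close> belongs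
  to that ball (\<open>accepts_if_hessian_close\<close>). It follows that every trial with \<open>p \<ge> (max B (psi A))\<^sup>2\<close> is accepted,
  where \<open>psi A = max (40 M0 R A)\<^bsup>1/3\<^esup> (8 \<delta> A)\<^bsup>1/2\<^esup>\<close> (\<open>npe_accepts\<close>, \<open>rejected_p_less\<close>).

  So \<open>p \<le> 2 (max B (psi A))\<^sup>2\<close> along the run, and \<open>\<alpha>\<close> is at least \<open>1 / (2 max B (psi A))\<close>. While
  \<open>psi A \<le> B\<close>, each iteration multiplies \<open>A\<close> by \<open>exp (1 / (2 B))\<close>; this is the exponential phase, and it lasts
  as long as \<open>R\<^sup>2 / (2 A) \<ge> \<epsilon>\<^sub>t\<^sub>r\<close> (\<open>psi_le_B_iff\<close>). Afterwards \<open>psi A\<close> grows by at least \<open>1/6\<close> per iteration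
  whichever of its two terms dominates (\<open>psi_linear\<close>), which gives the cubic and quadratic rates at once.\<close>

section \<open>Linear algebra and calculus on the subspaces\<close>

lemma Rd_add: "x \<in> Rd d \<Longrightarrow> y \<in> Rd d \<Longrightarrow> x + y \<in> Rd d"
  and Rd_diff: "x \<in> Rd d \<Longrightarrow> y \<in> Rd d \<Longrightarrow> x - y \<in> Rd d"
  and Rd_scale: "x \<in> Rd d \<Longrightarrow> a *\<^sub>R x \<in> Rd d"
  and Rd_neg: "x \<in> Rd d \<Longrightarrow> - x \<in> Rd d"
  and Rd_zero: "0 \<in> Rd d"
  by (auto simp: Rd_def)

lemmas Rd_closed = Rd_add Rd_diff Rd_scale Rd_neg Rd_zero

lemma Rd_finite_span: "\<exists>E. finite E \<and> independent E \<and> span E = Rd d"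
proof -
  obtain e where e: "e i \<in> Rd (Suc i)" "coord (e i) i = 1" "\<And>j. j < i \<Longrightarrow> coord (e i) j = 0" for i
  proof -
    have "\<exists>x. x \<in> Rd (Suc i) \<and> (\<forall>j<Suc i. coord x j = (if j = i then 1 else 0))" for i
      using Rd_exhaust[of "Suc i" "\<lambda>j. if j = i then 1 else 0"] by blast
    then obtain e where "\<And>i. e i \<in> Rd (Suc i) \<and> (\<forall>j<Suc i. coord (e i) j = (if j = i then 1 else 0))"
      by metis
    then show ?thesis by (intro that[of e]) auto
  qed
  have "Rd d \<subseteq> span (e ` {..<d})"
  proof (induction d)
    case 0
    show ?case by (auto simp: Rd_def intro: rvec_eqI)
  next
    case (Suc d)
    show ?case
    proof
      fix x assume x: "x \<in> Rd (Suc d)"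
      have "x - coord x d *\<^sub>R e d \<in> Rd d"
        unfolding Rd_def
      proof (intro CollectI allI impI)
        fix i assume "d \<le> i"
        then show "coord (x - coord x d *\<^sub>R e d) i = 0"
          using x e(1)[of d] e(2)[of d] by (cases "i = d") (auto simp: Rd_def)
      qed
      then have "x - coord x d *\<^sub>R e d \<in> span (e ` {..<Suc d})"
        using Suc span_mono[OF image_mono[of "{..<d}" "{..<Suc d}" e]] by auto
      moreover have "coord x d *\<^sub>R e d \<in> span (e ` {..<Suc d})"
        by (auto intro: span_scale span_base)
      ultimately have "(x - coord x d *\<^sub>R e d) + coord x d *\<^sub>R e d \<in> span (e ` {..<Suc d})"
        by (rule span_add)
      then show "x \<in> span (e ` {..<Suc d})" by simp
    qed
  qed
  moreover have "span (e ` {..<d}) \<subseteq> Rd d"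
    by (rule span_minimal[OF _ subspace_Rd]) (use e(1) in \<open>auto simp: Rd_def\<close>)
  ultimately have sp: "span (e ` {..<d}) = Rd d" by blast
  obtain E where "E \<subseteq> e ` {..<d}" "independent E" "e ` {..<d} \<subseteq> span E"
    by (metis maximal_independent_subset)
  moreover from this have "span E = span (e ` {..<d})"
    by (metis span_eq span_superset subset_trans)
  ultimately show ?thesis using sp by (intro exI[of _ E]) (auto intro: finite_subset)
qed

text \<open>The ambient space has infinite dimension, so that the usual equivalence of injectivity and
  surjectivity has to be obtained on the subspace, by counting a basis.\<close>

lemma Rd_inj_imp_surj:
  assumes lin: "linear T" and maps: "\<And>v. v \<in> Rd d \<Longrightarrow> T v \<in> Rd d"
    and inj: "\<And>v. v \<in> Rd d \<Longrightarrow> T v = 0 \<Longrightarrow> v = 0"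
    and y: "y \<in> Rd d"
  shows "\<exists>x\<in>Rd d. T x = y"
proof -
  interpret T: linear T by (rule lin)
  obtain E where E: "finite E" "independent E" "span E = Rd d"
    using Rd_finite_span by blast
  have inj': "inj_on T (span E)"
    by (intro inj_onI) (metis E(3) Rd_diff T.diff inj right_minus_eq)
  have ind: "independent (T ` E)"
    using linear_independent_injective_image[OF lin E(2) inj'] by simp
  have card: "card (T ` E) = card E"
    by (intro card_image inj_on_subset[OF inj'] span_superset)
  have "y \<in> span (T ` E)"
  proof (rule ccontr)
    assume n: "y \<notin> span (T ` E)"
    have "independent (insert y (T ` E))"
      using ind n by (simp add: independent_insert)
    moreover have "insert y (T ` E) \<subseteq> span E"
      using y maps span_superset[of E] unfolding E(3) by auto
    ultimately have "card (insert y (T ` E)) \<le> card E"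
      using independent_span_bound[OF E(1)] by blast
    moreover have "y \<notin> T ` E" using n span_base[of y "T ` E"] by metis
    ultimately have "Suc (card (T ` E)) \<le> card E"
      using finite_imageI[OF E(1), of T] by (metis card_insert_disjoint)
    then show False unfolding card by (rule Suc_n_not_le_n[THEN notE])
  qed
  then have "y \<in> T ` span E" by (simp only: linear_span_image[OF lin])
  then show ?thesis by (simp only: E(3) image_iff) blast
qed

lemma pos_def_solvable:
  assumes Q: "Q \<in> mats d" and pd: "pos_def d (Q + \<tau> *\<^sub>R id_blinfun)" and b: "b \<in> Rd d"
  shows "\<exists>s\<in>Rd d. blinfun_apply (Q + \<tau> *\<^sub>R id_blinfun) s = b"
proof (rule Rd_inj_imp_surj[OF _ _ _ b])
  show "linear (blinfun_apply (Q + \<tau> *\<^sub>R id_blinfun))"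
    by (simp add: blinfun.bounded_linear_right bounded_linear.linear)
  show "blinfun_apply (Q + \<tau> *\<^sub>R id_blinfun) v \<in> Rd d" if "v \<in> Rd d" for v
    using Q that by (simp add: blinfun.add_left blinfun.scaleR_left mats_def Rd_closed)
  show "v = 0" if "v \<in> Rd d" "blinfun_apply (Q + \<tau> *\<^sub>R id_blinfun) v = 0" for v
    using pd that unfolding pos_def_def by force
qed

lemma inner_blinfun_bound:
  fixes A :: "'a::real_inner \<Rightarrow>\<^sub>L 'a"
  assumes "norm A \<le> b"
  shows "\<bar>inner (blinfun_apply A u) v\<bar> \<le> b * norm u * norm v"
proof -
  have "\<bar>inner (blinfun_apply A u) v\<bar> \<le> norm (blinfun_apply A u) * norm v"
    by (rule Cauchy_Schwarz_ineq2)
  also have "norm (blinfun_apply A u) \<le> b * norm u"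
    by (meson assms mult_right_mono norm_blinfun norm_ge_zero order_trans)
  finally show ?thesis by (simp add: mult_right_mono)
qed

locale smooth_Rd =
  fixes d :: nat and f :: "rvec \<Rightarrow> real" and g :: "rvec \<Rightarrow> rvec"
    and D :: "rvec \<Rightarrow> (rvec \<Rightarrow>\<^sub>L rvec)"
  assumes C2: "C2_on_Rd d f g D"
begin

lemma g_Rd: "x \<in> Rd d \<Longrightarrow> g x \<in> Rd d"
  using C2 by (auto simp: C2_on_Rd_def)

lemma line_Rd: "x \<in> Rd d \<Longrightarrow> h \<in> Rd d \<Longrightarrow> x + t *\<^sub>R h \<in> Rd d"
  by (intro Rd_closed)

lemma f_line_deriv:
  assumes "x \<in> Rd d" "h \<in> Rd d"
  shows "((\<lambda>t. f (x + t *\<^sub>R h)) has_real_derivative inner (g (x + t *\<^sub>R h)) h) (at t)"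
proof -
  have l: "((\<lambda>t. x + t *\<^sub>R h) has_derivative (\<lambda>s. s *\<^sub>R h)) (at t)"
    by (auto intro!: derivative_eq_intros)
  have "(f has_derivative inner (g (x + t *\<^sub>R h))) (at (x + t *\<^sub>R h) within Rd d)"
    using C2 line_Rd[OF assms] by (auto simp: C2_on_Rd_def)
  then have "(f has_derivative inner (g (x + t *\<^sub>R h))) (at (x + t *\<^sub>R h) within range (\<lambda>t. x + t *\<^sub>R h))"
    by (rule has_derivative_subset) (use line_Rd[OF assms] in auto)
  from has_derivative_in_compose[OF l this]
  show ?thesis by (simp add: has_field_derivative_def mult_commute_abs)
qed

lemma g_line_deriv:
  assumes "x \<in> Rd d" "h \<in> Rd d"
  shows "((\<lambda>t. inner (g (x + t *\<^sub>R h)) u) has_real_derivative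
           inner (blinfun_apply (D (x + t *\<^sub>R h)) h) u) (at t)"
proof -
  have l: "((\<lambda>t. x + t *\<^sub>R h) has_derivative (\<lambda>s. s *\<^sub>R h)) (at t)"
    by (auto intro!: derivative_eq_intros)
  have "(g has_derivative blinfun_apply (D (x + t *\<^sub>R h))) (at (x + t *\<^sub>R h) within Rd d)"
    using C2 line_Rd[OF assms] by (auto simp: C2_on_Rd_def)
  then have "(g has_derivative blinfun_apply (D (x + t *\<^sub>R h))) (at (x + t *\<^sub>R h) within range (\<lambda>t. x + t *\<^sub>R h))"
    by (rule has_derivative_subset) (use line_Rd[OF assms] in auto)
  from has_derivative_inner_left[OF has_derivative_in_compose[OF l this], of u]
  show ?thesis
    by (simp add: has_field_derivative_def blinfun.scaleR_right mult_commute_abs)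
qed

text \<open>The affine growth of the Hessian error in \<open>t\<close> is kept, rather than its maximum over the segment,
  because the rejection bound of the initialization needs the factor \<open>1/2\<close> in front of \<open>b\<close>.\<close>

lemma newton_residual:
  assumes x: "x \<in> Rd d" and h: "h \<in> Rd d"
    and bd: "\<And>t. 0 \<le> t \<Longrightarrow> t \<le> 1 \<Longrightarrow> norm (D (x + t *\<^sub>R h) - Q) \<le> a + b * t"
  shows "norm (g (x + h) - g x - blinfun_apply Q h) \<le> (a + b / 2) * norm h"
proof -
  \<comment> \<open>Testing the residual against itself reduces the vector inequality to a scalar one.\<close>
  define r where "r = g (x + h) - g x - blinfun_apply Q h"
  define \<psi> where "\<psi> = (\<lambda>t. inner (g (x + t *\<^sub>R h)) r - t * inner (blinfun_apply Q h) r
                         - (a * t + b * t\<^sup>2 / 2) * (norm h * norm r))"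
  have "\<psi> 1 \<le> \<psi> 0"
  proof (rule DERIV_nonpos_imp_nonincreasing[where f = \<psi>])
    fix t :: real assume t: "0 \<le> t" "t \<le> 1"
    have "(\<psi> has_real_derivative inner (blinfun_apply (D (x + t *\<^sub>R h)) h) r - inner (blinfun_apply Q h) r
            - (a + b * t) * (norm h * norm r)) (at t)"
      unfolding \<psi>_def by (rule derivative_eq_intros g_line_deriv[OF x h] refl | simp)+
    moreover have "\<bar>inner (blinfun_apply (D (x + t *\<^sub>R h) - Q) h) r\<bar> \<le> (a + b * t) * norm h * norm r"
      by (rule inner_blinfun_bound[OF bd[OF t]])
    then have "inner (blinfun_apply (D (x + t *\<^sub>R h)) h) r - inner (blinfun_apply Q h) r
            - (a + b * t) * (norm h * norm r) \<le> 0"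
      by (simp add: blinfun.diff_left inner_diff_left mult.assoc)
    ultimately show "\<exists>y. DERIV \<psi> t :> y \<and> y \<le> 0" by blast
  qed simp
  then have "inner r r \<le> (a + b / 2) * (norm h * norm r)"
    by (simp add: \<psi>_def r_def inner_diff_left)
  then have "norm r * norm r \<le> ((a + b / 2) * norm h) * norm r"
    by (simp add: dot_square_norm power2_eq_square mult.assoc)
  moreover have "0 \<le> (a + b / 2) * norm h"
  proof -
    have "0 \<le> a" using order_trans[OF norm_ge_zero bd[of 0]] by simp
    moreover have "0 \<le> a + b" using order_trans[OF norm_ge_zero bd[of 1]] by simp
    ultimately have "0 \<le> a + b / 2" by simp
    then show ?thesis by simp
  qed
  ultimately have "norm r \<le> (a + b / 2) * norm h"
    by (cases "norm r = 0") (auto simp: mult_le_cancel_right)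
  then show ?thesis by (simp add: r_def)
qed

text \<open>Integrating the previous bound along the segment, with a sign \<open>\<sigma>\<close> to treat both directions of the
  error simultaneously.\<close>

lemma quadratic_model_error:
  assumes x: "x \<in> Rd d" and h: "h \<in> Rd d"
    and bd: "\<And>t. 0 \<le> t \<Longrightarrow> t \<le> 1 \<Longrightarrow> norm (D (x + t *\<^sub>R h) - Q) \<le> \<kappa>"
  shows "\<bar>f (x + h) - f x - inner (g x) h - inner (blinfun_apply Q h) h / 2\<bar> \<le> \<kappa> / 2 * (norm h)\<^sup>2"
proof -
  define F where "F = (\<lambda>\<sigma> t. \<sigma> * (f (x + t *\<^sub>R h) - t * inner (g x) h - t\<^sup>2 * inner (blinfun_apply Q h) h / 2)
                         - \<kappa> / 2 * t\<^sup>2 * (norm h)\<^sup>2)"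
  have "F \<sigma> 1 \<le> F \<sigma> 0" if \<sigma>: "\<bar>\<sigma>\<bar> = 1" for \<sigma>
  proof (rule DERIV_nonpos_imp_nonincreasing[where f = "F \<sigma>"])
    fix t :: real assume t: "0 \<le> t" "t \<le> 1"
    let ?r = "g (x + t *\<^sub>R h) - g x - blinfun_apply Q (t *\<^sub>R h)"
    have "(F \<sigma> has_real_derivative \<sigma> * (inner (g (x + t *\<^sub>R h)) h - inner (g x) h - t * inner (blinfun_apply Q h) h)
            - \<kappa> * t * (norm h)\<^sup>2) (at t)"
      unfolding F_def by (rule derivative_eq_intros f_line_deriv[OF x h] refl | simp)+
    then have "(F \<sigma> has_real_derivative \<sigma> * inner ?r h - \<kappa> * t * (norm h)\<^sup>2) (at t)"
      by (simp add: inner_diff_left blinfun.scaleR_right)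
    moreover have "norm ?r \<le> (\<kappa> + 0 / 2) * norm (t *\<^sub>R h)"
    proof (rule newton_residual[OF x Rd_scale[OF h]])
      fix u :: real assume "0 \<le> u" "u \<le> 1"
      then show "norm (D (x + u *\<^sub>R t *\<^sub>R h) - Q) \<le> \<kappa> + 0 * u"
        using bd[of "u * t"] t by (simp add: mult_le_one)
    qed
    then have "norm ?r * norm h \<le> (\<kappa> * t * norm h) * norm h"
      using t by (intro mult_right_mono) (auto simp: mult_ac)
    moreover have "\<sigma> * inner ?r h \<le> norm ?r * norm h"
      using Cauchy_Schwarz_ineq2[of ?r h] \<sigma>
      by (metis abs_ge_self abs_mult mult_1 order_trans)
    ultimately show "\<exists>y. DERIV (F \<sigma>) t :> y \<and> y \<le> 0"
      by (intro exI[of _ "\<sigma> * inner ?r h - \<kappa> * t * (norm h)\<^sup>2"]) (simp add: power2_eq_square mult.assoc)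
  qed simp
  from this[of 1] this[of "-1"] show ?thesis
    unfolding F_def by (intro abs_leI) simp_all
qed

end

locale convex_smooth_Rd = smooth_Rd +
  assumes convex: "convex_on (Rd d) f"
begin

lemma above_tangent:
  assumes x: "x \<in> Rd d" and y: "y \<in> Rd d"
  shows "f x + inner (g x) (y - x) \<le> f y"
proof -
  have h: "y - x \<in> Rd d" using x y by (rule Rd_diff[rotated])
  have "convex_on UNIV (\<lambda>t. f (x + t *\<^sub>R (y - x)))"
  proof (rule convex_onI)
    fix t a b :: real assume t: "0 < t" "t < 1"
    have eq: "x + ((1 - t) *\<^sub>R a + t *\<^sub>R b) *\<^sub>R (y - x)
          = (1 - t) *\<^sub>R (x + a *\<^sub>R (y - x)) + t *\<^sub>R (x + b *\<^sub>R (y - x))"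
      by (simp add: algebra_simps)
    show "f (x + ((1 - t) *\<^sub>R a + t *\<^sub>R b) *\<^sub>R (y - x))
          \<le> (1 - t) * f (x + a *\<^sub>R (y - x)) + t * f (x + b *\<^sub>R (y - x))"
      unfolding eq using t line_Rd[OF x h]
      by (intro convex_onD[OF convex]) auto
  qed simp
  from convex_on_imp_above_tangent[OF this, of 0 1 "inner (g x) (y - x)"]
  show ?thesis using f_line_deriv[OF x h, of 0] by simp
qed

text \<open>The gradient of a convex function is monotone along lines, so its derivative has a sign.\<close>

lemma hess_psd:
  assumes x: "x \<in> Rd d" and h: "h \<in> Rd d"
  shows "0 \<le> inner (blinfun_apply (D x) h) h"
proof -
  have "mono_on UNIV (\<lambda>t. inner (g (x + t *\<^sub>R h)) h)"
  proof (rule mono_onI)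
    fix a b :: real assume ab: "a \<le> b"
    let ?a = "x + a *\<^sub>R h" and ?b = "x + b *\<^sub>R h"
    have "f ?a + inner (g ?a) (?b - ?a) \<le> f ?b" "f ?b + inner (g ?b) (?a - ?b) \<le> f ?a"
      by (rule above_tangent[OF line_Rd[OF x h] line_Rd[OF x h]])+
    moreover have "?b - ?a = (b - a) *\<^sub>R h" "?a - ?b = - ((b - a) *\<^sub>R h)"
      by (auto simp: algebra_simps)
    ultimately have "(b - a) * inner (g ?a) h \<le> (b - a) * inner (g ?b) h"
      by simp
    then show "inner (g ?a) h \<le> inner (g ?b) h"
      using ab by (cases "a = b") (auto simp: mult_le_cancel_left)
  qed
  from mono_on_imp_deriv_nonneg[OF this g_line_deriv[OF x h, of h 0]]
  show ?thesis by simp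
qed

end


section \<open>Acceptance of a trial and decrease of the potential\<close>

context convex_smooth_Rd
begin

text \<open>The hypotheses do not mention \<open>s\<close>. To see that \<open>s\<close> cannot be long, compare the quadratic model at \<open>h0\<close>,
  where it is at most slightly larger than \<open>m + \<tau> \<eta>\<^sup>2 / 2\<close>, with the model on the segment from \<open>h0\<close> to its
  minimizer \<open>s\<close>. Inside the ball of radius \<open>3 \<eta>\<close> the model is bounded below by \<open>m\<close>, since its error is smaller
  than the term \<open>\<tau> |h|\<^sup>2 / 2\<close> it contains. By strong convexity it would drop by more than the available amount
  before leaving this ball if \<open>s\<close> lay outside. The step being short, the acceptance test is the bound on the Newton residual.\<close>

lemma accepts_if_hessian_close:
  assumes Q: "Q \<in> sym_mats d" and v: "v \<in> Rd d" and h0: "h0 \<in> Rd d" "norm h0 \<le> \<eta>"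
    and \<eta>: "0 < \<eta>" and \<tau>: "0 < \<tau>"
    and low: "\<And>x. x \<in> Rd d \<Longrightarrow> m \<le> f x"
    and gap: "f (v + h0) + \<tau> / 2 * (norm h0)\<^sup>2 \<le> m + \<tau> / 2 * \<eta>\<^sup>2"
    and close: "\<And>h. h \<in> Rd d \<Longrightarrow> norm h \<le> 3 * \<eta> \<Longrightarrow> norm (D (v + h) - Q) \<le> 9 / 20 * \<tau>"
  shows "\<exists>s. accepts d g Q v \<tau> s"
proof -
  define T where "T = blinfun_apply (Q + \<tau> *\<^sub>R id_blinfun)"
  have T: "T u = blinfun_apply Q u + \<tau> *\<^sub>R u" for u
    by (simp add: T_def blinfun.add_left blinfun.scaleR_left)
  have Qm: "Q \<in> mats d"
    and Qsym: "\<And>u w. u \<in> Rd d \<Longrightarrow> w \<in> Rd d \<Longrightarrow> inner (blinfun_apply Q u) w = inner u (blinfun_apply Q w)"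
    using Q by (auto simp: sym_mats_def)
  have Tsym: "inner (T u) w = inner (T w) u" if "u \<in> Rd d" "w \<in> Rd d" for u w
    using Qsym[OF that] by (simp add: T inner_add_left inner_add_right inner_commute)
  have Tadd: "T (a + b) = T a + T b" and Tscale: "T (c *\<^sub>R a) = c *\<^sub>R T a" for a b c
    by (auto simp: T algebra_simps blinfun.add_right blinfun.scaleR_right)
  have T_coercive: "11 / 20 * \<tau> * (norm u)\<^sup>2 \<le> inner (T u) u" if u: "u \<in> Rd d" for u
  proof -
    have "norm (D v - Q) \<le> 9 / 20 * \<tau>"
      using close[of 0] \<eta> by (simp add: Rd_zero)
    from abs_le_D1[OF inner_blinfun_bound[OF this, of u u]] hess_psd[OF v u]
    show ?thesis by (simp add: T inner_add_left blinfun.diff_left inner_diff_left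
          dot_square_norm power2_eq_square mult.assoc)
  qed
  have pd: "pos_def d (Q + \<tau> *\<^sub>R id_blinfun)"
    unfolding pos_def_def T_def[symmetric]
  proof (intro ballI impI)
    fix u :: rvec assume u: "u \<in> Rd d" "u \<noteq> 0"
    then have "0 < 11 / 20 * \<tau> * (norm u)\<^sup>2" using \<tau> by simp
    then show "0 < inner (T u) u" using T_coercive[OF u(1)] by simp
  qed
  obtain s where s: "s \<in> Rd d" "T s = - g v"
    using pos_def_solvable[OF Qm pd Rd_neg[OF g_Rd[OF v]]] unfolding T_def by blast
  define model where "model = (\<lambda>h. f v + inner (g v) h + inner (T h) h / 2)"
  have model_err: "\<bar>f (v + h) + \<tau> / 2 * (norm h)\<^sup>2 - model h\<bar> \<le> 9 / 40 * \<tau> * (norm h)\<^sup>2"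
    if h: "h \<in> Rd d" "norm h \<le> 3 * \<eta>" for h
  proof -
    have "norm (D (v + t *\<^sub>R h) - Q) \<le> 9 / 20 * \<tau>" if "0 \<le> t" "t \<le> 1" for t
    proof (rule close[OF Rd_scale[OF h(1)]])
      have "\<bar>t\<bar> * norm h \<le> 1 * norm h" using that by (intro mult_right_mono) auto
      then show "norm (t *\<^sub>R h) \<le> 3 * \<eta>" using h(2) by simp
    qed
    from quadratic_model_error[OF v h(1), of Q "9 / 20 * \<tau>", OF this]
    show ?thesis
      unfolding model_def T inner_add_left inner_scaleR_left dot_square_norm[symmetric]
      by (simp add: dot_square_norm algebra_simps add_divide_distrib)
  qed
  define e where "e = s - h0"
  have eR: "e \<in> Rd d" unfolding e_def using s(1) h0(1) by (rule Rd_diff)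
  have model_drop: "model h0 - model (h0 + \<theta> *\<^sub>R e) = (\<theta> - \<theta>\<^sup>2 / 2) * inner (T e) e" for \<theta>
  proof -
    have "- g v = T h0 + T e"
      using s(2) Tadd[of h0 e] by (simp add: e_def)
    then have "inner (- g v) e = inner (T h0) e + inner (T e) e"
      by (simp add: inner_add_left)
    then have gv: "inner (g v) e = - inner (T h0) e - inner (T e) e" by simp
    have "model h0 - model (h0 + \<theta> *\<^sub>R e)
       = - \<theta> * inner (g v) e - \<theta> * inner (T h0) e / 2 - \<theta> * inner (T e) h0 / 2
         - \<theta>\<^sup>2 * inner (T e) e / 2"
      by (simp add: model_def Tadd Tscale inner_add_left inner_add_right power2_eq_square field_simps)
    also have "inner (T e) h0 = inner (T h0) e" by (rule Tsym[OF eR h0(1)])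
    finally show ?thesis by (simp add: gv algebra_simps)
  qed
  \<comment> \<open>Any point of the segment that stays in the ball gives a bound on \<open>s - h0\<close>.\<close>
  have key: "(\<theta> - \<theta>\<^sup>2 / 2) * (11 / 20) * (norm e)\<^sup>2 \<le> 29 / 40 * \<eta>\<^sup>2"
    if \<theta>: "0 \<le> \<theta>" "\<theta> \<le> 1" "\<theta> * norm e \<le> 2 * \<eta>" for \<theta>
  proof -
    let ?h = "h0 + \<theta> *\<^sub>R e"
    have hR: "?h \<in> Rd d" by (rule line_Rd[OF h0(1) eR])
    have "norm ?h \<le> norm h0 + \<theta> * norm e" using norm_triangle_ineq[of h0 "\<theta> *\<^sub>R e"] \<theta> by simp
    then have hb: "norm ?h \<le> 3 * \<eta>" using h0(2) \<theta>(3) by simp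
    have "m \<le> f (v + ?h)" by (rule low[OF Rd_add[OF v hR]])
    moreover have "f (v + ?h) + \<tau> / 2 * (norm ?h)\<^sup>2 - model ?h \<le> 9 / 40 * \<tau> * (norm ?h)\<^sup>2"
      by (rule abs_le_D1[OF model_err[OF hR hb]])
    moreover have "9 / 40 * \<tau> * (norm ?h)\<^sup>2 \<le> \<tau> / 2 * (norm ?h)\<^sup>2"
      using \<tau> by (intro mult_right_mono) auto
    ultimately have 1: "m \<le> model ?h" by linarith
    have "norm h0 \<le> 3 * \<eta>" using h0(2) \<eta> by simp
    from abs_le_D2[OF model_err[OF h0(1) this]]
    have "model h0 \<le> f (v + h0) + \<tau> / 2 * (norm h0)\<^sup>2 + 9 / 40 * \<tau> * (norm h0)\<^sup>2" by linarith
    moreover have "9 / 40 * \<tau> * (norm h0)\<^sup>2 \<le> 9 / 40 * \<tau> * \<eta>\<^sup>2"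
      using \<tau> h0(2) by (intro mult_left_mono power_mono) auto
    ultimately have 2: "model h0 \<le> m + 29 / 40 * \<tau> * \<eta>\<^sup>2" using gap by (simp add: algebra_simps)
    have c: "0 \<le> \<theta> - \<theta>\<^sup>2 / 2" using \<theta> by (simp add: power2_eq_square field_simps) (smt (verit) mult_left_le)
    have "(\<theta> - \<theta>\<^sup>2 / 2) * (11 / 20 * \<tau> * (norm e)\<^sup>2) \<le> (\<theta> - \<theta>\<^sup>2 / 2) * inner (T e) e"
      by (rule mult_left_mono[OF T_coercive[OF eR] c])
    also have "\<dots> \<le> 29 / 40 * \<tau> * \<eta>\<^sup>2"
      using 1 2 model_drop[of \<theta>] by simp
    finally have "\<tau> * ((\<theta> - \<theta>\<^sup>2 / 2) * (11 / 20) * (norm e)\<^sup>2) \<le> \<tau> * (29 / 40 * \<eta>\<^sup>2)"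
      by (simp only: mult_ac)
    then show ?thesis using \<tau> by (simp add: mult_le_cancel_left)
  qed
  have e_le: "norm e \<le> 2 * \<eta>"
  proof (rule ccontr)
    assume n: "\<not> norm e \<le> 2 * \<eta>"
    \<comment> \<open>The point at which the segment has length \<open>2 \<eta>\<close>, hence is still inside the ball.\<close>
    define \<theta> where "\<theta> = 2 * \<eta> / norm e"
    have "0 < norm e" using n \<eta> by linarith
    then have \<theta>e: "\<theta> * norm e = 2 * \<eta>" and \<theta>: "0 \<le> \<theta>" "\<theta> \<le> 1"
      using n \<eta> by (auto simp: \<theta>_def field_simps)
    have "\<theta>\<^sup>2 / 2 \<le> \<theta> - \<theta>\<^sup>2 / 2" using \<theta> by (simp add: power2_eq_square mult_left_le)
    then have "\<theta>\<^sup>2 / 2 * ((11 / 20) * (norm e)\<^sup>2) \<le> (\<theta> - \<theta>\<^sup>2 / 2) * ((11 / 20) * (norm e)\<^sup>2)"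
      by (intro mult_right_mono) auto
    also have "\<dots> = (\<theta> - \<theta>\<^sup>2 / 2) * (11 / 20) * (norm e)\<^sup>2" by (simp only: mult.assoc)
    also have "\<dots> \<le> 29 / 40 * \<eta>\<^sup>2" by (rule key[OF \<theta> eq_refl[OF \<theta>e]])
    finally have "11 / 40 * (\<theta> * norm e)\<^sup>2 \<le> 29 / 40 * \<eta>\<^sup>2"
      by (simp add: power_mult_distrib mult_ac)
    then show False using \<eta> by (simp add: \<theta>e)
  qed
  have s_le: "norm s \<le> 3 * \<eta>"
    using norm_triangle_ineq[of h0 e] e_le h0(2) by (simp add: e_def)
  have "norm (g (v + s) - g v - blinfun_apply Q s) \<le> (9 / 20 * \<tau> + 0 / 2) * norm s"
  proof (rule newton_residual[OF v s(1)])
    fix t :: real assume t: "0 \<le> t" "t \<le> 1"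
    have "\<bar>t\<bar> * norm s \<le> 1 * norm s" using t by (intro mult_right_mono) auto
    then show "norm (D (v + t *\<^sub>R s) - Q) \<le> 9 / 20 * \<tau> + 0 * t"
      using close[OF Rd_scale[OF s(1)], of t] s_le by simp
  qed
  moreover have "g (v + s) - g v - blinfun_apply Q s = g (v + s) + \<tau> *\<^sub>R s"
    using s(2) by (simp add: T algebra_simps eq_neg_iff_add_eq_0)
  moreover have "9 / 20 * \<tau> * norm s \<le> \<tau> / 2 * norm s"
    using \<tau> by (intro mult_right_mono) auto
  ultimately have "norm (g (v + s) + \<tau> *\<^sub>R s) \<le> \<tau> / 2 * norm s" by simp
  then show ?thesis unfolding accepts_def using pd s unfolding T_def by blast
qed

text \<open>The acceptance test says that \<open>s\<close> is a proximal step up to a relative error \<open>1/2\<close>; squaring it yields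
  \<open>|G|\<^sup>2 + 2 \<tau> \<langle>G, s\<rangle> \<le> - 3/4 \<tau>\<^sup>2 |s|\<^sup>2\<close> for the new gradient \<open>G\<close>, and this is exactly the combination left over
  when the tangent inequalities at the new point, with weights \<open>A\<close> and \<open>a\<close>, are added to the expansion of
  \<open>|z - a G - x\<^sup>*|\<^sup>2\<close>. With \<open>A = 0\<close> this covers the initialization.\<close>

lemma accelerated_step_decrease:
  assumes w: "w \<in> Rd d" and v: "v \<in> Rd d" and s: "s \<in> Rd d" and xs: "xs \<in> Rd d"
    and A: "0 \<le> A" "0 < a" "A' = A + a" "a\<^sup>2 * \<tau> = A'"
    and \<tau>: "0 < \<tau>" and v_eq: "A' *\<^sub>R v = A *\<^sub>R w + a *\<^sub>R z"
    and acc: "norm (g (v + s) + \<tau> *\<^sub>R s) \<le> \<tau> / 2 * norm s"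
  shows "A' * (f (v + s) - f xs) + (norm (z - a *\<^sub>R g (v + s) - xs))\<^sup>2 / 2
           + 3 / 8 * (A' * \<tau> * (norm s)\<^sup>2)
         \<le> A * (f w - f xs) + (norm (z - xs))\<^sup>2 / 2"
proof -
  define w' where "w' = v + s"
  define G where "G = g w'"
  have w': "w' \<in> Rd d" unfolding w'_def using v s by (rule Rd_add)
  have "A * (f w' + inner G (w - w')) \<le> A * f w"
    unfolding G_def by (intro mult_left_mono above_tangent w w' A)
  moreover have "a * (f w' + inner G (xs - w')) \<le> a * f xs"
    unfolding G_def using A by (intro mult_left_mono above_tangent xs w') auto
  moreover have "A * inner G (w - w') + a * inner G (xs - w') = - A' * inner G s + a * inner G (xs - z)"
  proof -
    have "A * inner G (w - w') + a * inner G (xs - w')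
        = inner G (A *\<^sub>R w + a *\<^sub>R z) - A' * inner G w' + a * inner G (xs - z)"
      by (simp add: A(3) inner_diff_right inner_add_right algebra_simps)
    then show ?thesis by (simp add: v_eq[symmetric] w'_def inner_add_right algebra_simps)
  qed
  ultimately have 1: "A' * f w' \<le> A * f w + a * f xs + A' * inner G s - a * inner G (xs - z)"
    by (simp add: A(3) algebra_simps)
  have 2: "(norm (z - a *\<^sub>R G - xs))\<^sup>2 / 2 = (norm (z - xs))\<^sup>2 / 2 + a * inner G (xs - z) + a\<^sup>2 * (norm G)\<^sup>2 / 2"
    unfolding power2_norm_eq_inner
    by (simp add: inner_diff_left inner_diff_right inner_add_left inner_add_right inner_commute
        power2_eq_square field_simps)
  have "(norm (G + \<tau> *\<^sub>R s))\<^sup>2 \<le> (\<tau> / 2 * norm s)\<^sup>2"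
    using acc by (intro power_mono) (auto simp: G_def w'_def)
  then have 3: "(norm G)\<^sup>2 + 2 * \<tau> * inner G s + \<tau>\<^sup>2 * (norm s)\<^sup>2 \<le> \<tau>\<^sup>2 / 4 * (norm s)\<^sup>2"
    unfolding power2_norm_eq_inner power_mult_distrib
    by (simp add: inner_add_left inner_add_right inner_commute power2_eq_square field_simps)
  have "a\<^sup>2 * ((norm G)\<^sup>2 + 2 * \<tau> * inner G s) \<le> a\<^sup>2 * (- 3 / 4 * (\<tau>\<^sup>2 * (norm s)\<^sup>2))"
    using 3 by (intro mult_left_mono) auto
  then have "a\<^sup>2 * (norm G)\<^sup>2 + 2 * A' * inner G s \<le> - 3 / 4 * (A' * \<tau> * (norm s)\<^sup>2)"
    by (simp add: A(4)[symmetric] power2_eq_square algebra_simps)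
  then show ?thesis using 1 2 unfolding G_def[symmetric] w'_def[symmetric]
    by (simp add: A(3) algebra_simps)
qed

end


section \<open>Step weights and the invariant of an iteration\<close>

definition alpha :: "real \<Rightarrow> real" where
  "alpha p = 2 / (1 + sqrt (1 + 4 * p))"

lemma npe_alpha_eq: "npe_alpha A \<tau> = alpha (A * \<tau>)"
  by (simp add: npe_alpha_def alpha_def mult.assoc)

lemma alpha_pos: "0 < p \<Longrightarrow> 0 < alpha p"
  unfolding alpha_def by (intro divide_pos_pos add_pos_nonneg) auto

lemma alpha_less_1:
  assumes "0 < p"
  shows "alpha p < 1"
proof -
  have "1 < sqrt (1 + 4 * p)" using assms by simp
  then show ?thesis unfolding alpha_def by (subst divide_less_eq_1_pos) (auto intro: add_pos_nonneg)
qed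

lemma alpha_sq:
  assumes "0 < p"
  shows "p * (alpha p)\<^sup>2 = 1 - alpha p"
proof -
  define q where "q = sqrt (1 + 4 * p)"
  have q: "1 < q" "q\<^sup>2 = 1 + 4 * p" using assms by (auto simp: q_def)
  have p_eq: "p = (q - 1) * (q + 1) / 4" using q(2) by (simp add: power2_eq_square algebra_simps)
  have "(q - 1) * (q + 1) / 4 * (2 / (1 + q))\<^sup>2 = (q - 1) / (q + 1)"
    using q(1) by (simp add: power2_eq_square divide_simps add.commute)
  then have "p * (2 / (1 + q))\<^sup>2 = (q - 1) / (q + 1)" by (simp only: p_eq)
  also have "\<dots> = 1 - 2 / (1 + q)" using q(1) by (simp add: field_simps)
  finally show ?thesis by (simp add: alpha_def q_def)
qed

lemma alpha_antimono: "0 < p \<Longrightarrow> p \<le> p' \<Longrightarrow> alpha p' \<le> alpha p"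
  unfolding alpha_def by (intro divide_left_mono add_mono mult_pos_pos add_pos_nonneg) auto

lemma alpha_le_inverse:
  assumes "0 < \<Theta>" "\<Theta>\<^sup>2 \<le> p"
  shows "alpha p \<le> 1 / \<Theta>"
proof -
  have p: "0 < p" using assms by (meson less_le_trans zero_less_power)
  have "(alpha p * \<Theta>)\<^sup>2 \<le> (alpha p)\<^sup>2 * p"
    using assms by (simp add: power_mult_distrib mult_left_mono)
  also have "\<dots> \<le> 1\<^sup>2" using alpha_sq[OF p] alpha_pos[OF p] by (simp add: mult.commute)
  finally have "alpha p * \<Theta> \<le> 1" by (rule power2_le_imp_le) simp
  then show ?thesis using assms by (simp add: field_simps)
qed

lemma alpha_ge:
  assumes "0 < p" "1 \<le> \<Theta>" "p \<le> 2 * \<Theta>\<^sup>2"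
  shows "1 / (2 * \<Theta>) \<le> alpha p"
proof -
  have "1 \<le> \<Theta>\<^sup>2" using assms by simp
  then have "1 + 4 * p \<le> (3 * \<Theta>)\<^sup>2" using assms(3) by (simp add: power_mult_distrib)
  then have "sqrt (1 + 4 * p) \<le> 3 * \<Theta>" using assms(2) by (intro real_le_lsqrt) auto
  then have "1 + sqrt (1 + 4 * p) \<le> 4 * \<Theta>" using assms(2) by linarith
  moreover have "0 < 1 + sqrt (1 + 4 * p)" using assms(1) by (intro add_pos_nonneg) auto
  ultimately have "2 / (4 * \<Theta>) \<le> alpha p"
    unfolding alpha_def using assms(2) by (intro divide_left_mono mult_pos_pos) auto
  then show ?thesis by simp
qed

text \<open>The global and the local smoothness conditions are the cases \<open>\<rho> = \<infinity>\<close> and \<open>\<rho> < \<infinity>\<close> of one assumption.\<close>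

locale npe_problem = convex_smooth_Rd +
  fixes H :: "rvec \<Rightarrow> (rvec \<Rightarrow>\<^sub>L rvec)" and \<delta> M0 M1 :: real and \<rho> :: ereal and xs x0 :: rvec
  assumes xs: "xs \<in> Rd d" and x0: "x0 \<in> Rd d" and x0_neq: "x0 \<noteq> xs"
    and minimizer: "\<And>x. x \<in> Rd d \<Longrightarrow> f xs \<le> f x"
    and H_sym: "\<And>x. x \<in> Rd d \<Longrightarrow> H x \<in> sym_mats d"
    and H_err: "\<And>x. x \<in> Rd d \<Longrightarrow> norm (H x - D x) \<le> \<delta>"
    and M0: "0 \<le> M0" and M1: "0 \<le> M1" and \<rho>: "0 < \<rho>"
    and hess_smooth: "\<And>x y. x \<in> Rd d \<Longrightarrow> y \<in> Rd d \<Longrightarrow> ereal (norm (y - x)) \<le> \<rho> \<Longrightarrow>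
       norm (D y - D x) \<le> gen_L g M0 M1 x * norm (y - x)"
begin

definition R where "R = norm (x0 - xs)"

definition B where "B = B_const M1 R \<rho>"

lemma R_pos: "0 < R" using x0_neq by (simp add: R_def)

lemma \<delta>_nonneg: "0 \<le> \<delta>" using H_err[OF x0] norm_ge_zero order_trans by blast

lemma B_ge_1: "1 \<le> B" unfolding B_def B_const_def by (intro Max_ge) auto

lemma B_ge_M1: "64 * M1 * R\<^sup>2 \<le> B\<^sup>2"
proof -
  have "8 * sqrt M1 * R \<le> B" unfolding B_def B_const_def by (intro Max_ge) auto
  then have "(8 * sqrt M1 * R)\<^sup>2 \<le> B\<^sup>2"
    using M1 R_pos by (intro power_mono mult_nonneg_nonneg) auto
  then show ?thesis using M1 by (simp add: power_mult_distrib)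
qed

lemma within_radius: "t \<le> 8 * R / B \<Longrightarrow> ereal t \<le> \<rho>"
proof (cases \<rho>)
  case (real r)
  assume t: "t \<le> 8 * R / B"
  have r: "0 < r" using \<rho> real by simp
  have "div_ext (8 * R) \<rho> \<le> B" unfolding B_def B_const_def by (intro Max_ge) auto
  moreover have "div_ext (8 * R) \<rho> = 8 * R / r" unfolding real using r by (simp add: div_ext_def)
  ultimately have "8 * R / r \<le> B" by simp
  then have "8 * R / B \<le> r" using r B_ge_1 by (simp add: field_simps)
  then show ?thesis using t real by simp
qed (use \<rho> in auto)

text \<open>The first bound is the potential argument; the decrease of the potential bounds \<open>A' |s|\<close> by \<open>2 / \<surd>3 a R\<close>, rounded
  up to \<open>29/25 a R\<close>, which propagates the bound on \<open>|w - x\<^sup>*|\<close> through the convex combination defining \<open>v\<close>. The gradient is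
  at most \<open>3/2 \<tau> |s|\<close> by the acceptance test; this gives the third bound.\<close>

lemma accelerated_step_bounds:
  assumes w: "w \<in> Rd d" and v: "v \<in> Rd d" and s: "s \<in> Rd d"
    and A: "0 \<le> A" "0 < a" "A' = A + a" "a\<^sup>2 * \<tau> = A'"
    and \<tau>: "0 < \<tau>" and v_eq: "A' *\<^sub>R v = A *\<^sub>R w + a *\<^sub>R z"
    and acc: "norm (g (v + s) + \<tau> *\<^sub>R s) \<le> \<tau> / 2 * norm s"
    and E: "A * (f w - f xs) + (norm (z - xs))\<^sup>2 / 2 \<le> R\<^sup>2 / 2"
    and w_bd: "A * norm (w - xs) \<le> A * (54 / 25 * R)"
  shows "A' * (f (v + s) - f xs) + (norm (z - a *\<^sub>R g (v + s) - xs))\<^sup>2 / 2 \<le> R\<^sup>2 / 2"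
    and "norm (v + s - xs) \<le> 54 / 25 * R"
    and "a * norm (g (v + s)) \<le> 87 / 50 * R"
proof -
  have A': "0 < A'" using A by simp
  note dec = accelerated_step_decrease[OF w v s xs A \<tau> v_eq acc]
  have "0 \<le> A' * \<tau> * (norm s)\<^sup>2" using A' \<tau> by simp
  then show "A' * (f (v + s) - f xs) + (norm (z - a *\<^sub>R g (v + s) - xs))\<^sup>2 / 2 \<le> R\<^sup>2 / 2"
    using dec E by linarith
  have "0 \<le> A' * (f (v + s) - f xs)"
    using A' minimizer[OF Rd_add[OF v s]] by simp
  moreover have "0 \<le> (norm (z - a *\<^sub>R g (v + s) - xs))\<^sup>2 / 2" by simp
  ultimately have s2: "A' * \<tau> * (norm s)\<^sup>2 \<le> 4 / 3 * R\<^sup>2" using dec E by linarith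
  have A'\<tau>: "a\<^sup>2 * (A' * \<tau>) = A'\<^sup>2"
    unfolding A(4)[symmetric] by (simp add: power2_eq_square)
  have "(A' * norm s)\<^sup>2 = a\<^sup>2 * (A' * \<tau> * (norm s)\<^sup>2)"
    by (simp add: power_mult_distrib A'\<tau>[symmetric])
  also have "\<dots> \<le> a\<^sup>2 * (4 / 3 * R\<^sup>2)" using s2 by (intro mult_left_mono) auto
  also have "\<dots> \<le> (29 / 25 * (a * R))\<^sup>2"
  proof -
    have "(29 / 25 * (a * R))\<^sup>2 = 841 / 625 * (a\<^sup>2 * R\<^sup>2)" by (simp add: power_mult_distrib power2_eq_square)
    moreover have "0 \<le> a\<^sup>2 * R\<^sup>2" by simp
    ultimately show ?thesis by linarith
  qed
  finally have s_le: "A' * norm s \<le> 29 / 25 * (a * R)"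
    by (rule power2_le_imp_le) (use A(2) R_pos in auto)
  have "(norm (z - xs))\<^sup>2 \<le> R\<^sup>2"
    using E mult_nonneg_nonneg[OF A(1), of "f w - f xs"] minimizer[OF w] by simp
  then have z_le: "norm (z - xs) \<le> R" using power2_le_imp_le R_pos by (meson less_imp_le)
  have "A' * norm (v + s - xs) = norm (A' *\<^sub>R (v + s - xs))" using A' by simp
  also have "A' *\<^sub>R (v + s - xs) = A *\<^sub>R (w - xs) + a *\<^sub>R (z - xs) + A' *\<^sub>R s"
    unfolding scaleR_diff_right scaleR_add_right v_eq by (simp add: A(3) scaleR_add_left)
  also have "norm \<dots> \<le> A * norm (w - xs) + a * norm (z - xs) + A' * norm s"
    using norm_triangle_ineq[of "A *\<^sub>R (w - xs) + a *\<^sub>R (z - xs)" "A' *\<^sub>R s"]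
      norm_triangle_ineq[of "A *\<^sub>R (w - xs)" "a *\<^sub>R (z - xs)"] A A' by simp
  also have "\<dots> \<le> A * (54 / 25 * R) + a * R + 29 / 25 * (a * R)"
    using w_bd s_le mult_left_mono[OF z_le, of a] A(2) by linarith
  also have "\<dots> = A' * (54 / 25 * R)" by (simp add: A(3) algebra_simps)
  finally show "norm (v + s - xs) \<le> 54 / 25 * R" using A' by simp
  have "norm (g (v + s)) \<le> norm (g (v + s) + \<tau> *\<^sub>R s) + norm (\<tau> *\<^sub>R s)"
    using norm_triangle_ineq4[of "g (v + s) + \<tau> *\<^sub>R s" "\<tau> *\<^sub>R s"] by simp
  then have "norm (g (v + s)) \<le> 3 / 2 * \<tau> * norm s" using acc \<tau> by simp
  then have "a * norm (g (v + s)) \<le> a * (3 / 2 * \<tau> * norm s)" using A by (intro mult_left_mono) auto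
  then have "a * (a * norm (g (v + s))) \<le> a * (a * (3 / 2 * \<tau> * norm s))"
    using A by (intro mult_left_mono) auto
  also have "\<dots> = 3 / 2 * (a\<^sup>2 * \<tau> * norm s)" by (simp add: power2_eq_square)
  also have "\<dots> \<le> a * (87 / 50 * R)" unfolding A(4) using s_le by simp
  finally show "a * norm (g (v + s)) \<le> 87 / 50 * R" using A(2) by simp
qed

text \<open>Here \<open>p\<close> stands for \<open>A \<tau>\<close> with the first trial value \<open>\<tau>\<close>. The last conjunct bounds the gradient at the point where the
  Hessian is evaluated; as \<open>alpha\<close> is decreasing, it persists when rejections enlarge \<open>p\<close>.\<close>

definition npe_inv where
  "npe_inv w z A p \<longleftrightarrow> w \<in> Rd d \<and> z \<in> Rd d \<and> 0 < A \<and> 1 \<le> p \<and>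
     A * (f w - f xs) + (norm (z - xs))\<^sup>2 / 2 \<le> R\<^sup>2 / 2 \<and>
     norm (w - xs) \<le> 54 / 25 * R \<and>
     A * alpha p * norm (g w) \<le> 87 / 50 * R"

lemma npe_inv_gap:
  assumes "npe_inv w z A p"
  shows "f w - f xs \<le> R\<^sup>2 / (2 * A)"
proof -
  have "A * (f w - f xs) + (norm (z - xs))\<^sup>2 / 2 \<le> R\<^sup>2 / 2" "0 < A" "0 \<le> (norm (z - xs))\<^sup>2 / 2"
    using assms by (simp_all add: npe_inv_def)
  then have "A * (f w - f xs) \<le> R\<^sup>2 / 2" "0 < A" by linarith+
  then show ?thesis by (simp add: field_simps)
qed

lemma npe_inv_z:
  assumes "npe_inv w z A p"
  shows "norm (z - xs) \<le> R"
proof -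
  have "0 \<le> A * (f w - f xs)"
    using assms minimizer[of w] by (auto simp: npe_inv_def)
  then have "(norm (z - xs))\<^sup>2 \<le> R\<^sup>2" using assms by (simp add: npe_inv_def)
  then show ?thesis using power2_le_imp_le R_pos by (meson less_imp_le)
qed

lemma npe_v_Rd: "w \<in> Rd d \<Longrightarrow> z \<in> Rd d \<Longrightarrow> npe_v w z A \<tau> \<in> Rd d"
  unfolding npe_v_def by (intro Rd_closed)

lemma npe_inv_step:
  assumes G: "npe_inv w z A P" and p: "P \<le> p" "p = A * \<tau>"
    and acc: "accepts d g (H w) (npe_v w z A \<tau>) \<tau> s"
  shows "npe_inv (npe_v w z A \<tau> + s)
           (z - (alpha p * (A / (1 - alpha p))) *\<^sub>R g (npe_v w z A \<tau> + s)) (A / (1 - alpha p)) p"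
proof -
  have A: "0 < A" and p1: "1 \<le> p" and w: "w \<in> Rd d" and z: "z \<in> Rd d"
    using G p by (auto simp: npe_inv_def)
  have \<tau>: "0 < \<tau>" using A p p1 by (metis less_le_trans zero_less_mult_pos zero_less_one)
  have al: "0 < alpha p" "alpha p < 1" "p * (alpha p)\<^sup>2 = 1 - alpha p"
    using p1 alpha_pos[of p] alpha_less_1[of p] alpha_sq[of p] by auto
  define A' where "A' = A / (1 - alpha p)"
  define a where "a = alpha p * A'"
  have A': "0 < A'" using A al by (simp add: A'_def)
  have A_eq: "A = (1 - alpha p) * A'" using al by (simp add: A'_def)
  have a: "0 < a" "A' = A + a" using al A' by (simp_all add: a_def A_eq algebra_simps)
  have "A * \<tau> * (alpha p)\<^sup>2 * A' = (1 - alpha p) * A'" using al(3) by (simp add: p(2))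
  then have "A * (a\<^sup>2 * \<tau>) = A * A'" unfolding a_def using A_eq by (simp add: power2_eq_square mult_ac)
  then have a\<tau>: "a\<^sup>2 * \<tau> = A'" using A by simp
  have v: "npe_v w z A \<tau> \<in> Rd d" and s: "s \<in> Rd d"
    using npe_v_Rd[OF w z] acc by (auto simp: accepts_def)
  have v_eq: "A' *\<^sub>R npe_v w z A \<tau> = A *\<^sub>R w + a *\<^sub>R z"
  proof -
    have "npe_v w z A \<tau> = (1 - alpha p) *\<^sub>R w + alpha p *\<^sub>R z"
      by (simp add: npe_v_def npe_alpha_eq p(2))
    then show ?thesis unfolding \<open>npe_v w z A \<tau> = _\<close> by (simp add: A_eq a_def scaleR_add_right mult.commute)
  qed
  have acc': "norm (g (npe_v w z A \<tau> + s) + \<tau> *\<^sub>R s) \<le> \<tau> / 2 * norm s"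
    using acc by (simp add: accepts_def)
  have E: "A * (f w - f xs) + (norm (z - xs))\<^sup>2 / 2 \<le> R\<^sup>2 / 2" using G by (simp add: npe_inv_def)
  have w_bd: "A * norm (w - xs) \<le> A * (54 / 25 * R)" using G A by (simp add: npe_inv_def)
  note bds = accelerated_step_bounds[OF w v s less_imp_le[OF A] a a\<tau> \<tau> v_eq acc' E w_bd]
  have "A' * alpha p = a" by (simp add: a_def)
  moreover have "npe_v w z A \<tau> + s \<in> Rd d" using v s by (rule Rd_add)
  moreover have "z - a *\<^sub>R g (npe_v w z A \<tau> + s) \<in> Rd d"
    using z v s by (intro Rd_diff Rd_scale g_Rd Rd_add)
  ultimately show ?thesis
    unfolding npe_inv_def A'_def[symmetric] a_def[symmetric] using bds A' p1 by simp
qed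

lemma npe_inv_start:
  assumes \<tau>: "0 < \<tau>" and acc: "accepts d g (H x0) x0 \<tau> s"
  shows "npe_inv (x0 + s) (x0 - (1 / \<tau>) *\<^sub>R g (x0 + s)) (1 / \<tau>) 1"
proof -
  have s: "s \<in> Rd d" and acc': "norm (g (x0 + s) + \<tau> *\<^sub>R s) \<le> \<tau> / 2 * norm s"
    using acc by (auto simp: accepts_def)
  have a: "0 < 1 / \<tau>" "1 / \<tau> = 0 + 1 / \<tau>" "(1 / \<tau>)\<^sup>2 * \<tau> = 1 / \<tau>"
    using \<tau> by (auto simp: power2_eq_square)
  have "0 * (f x0 - f xs) + (norm (x0 - xs))\<^sup>2 / 2 \<le> R\<^sup>2 / 2" by (simp add: R_def)
  note bds = accelerated_step_bounds[OF x0 x0 s order_refl a \<tau> _ acc' this]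
  have "1 / \<tau> * alpha 1 * norm (g (x0 + s)) \<le> 1 / \<tau> * 1 * norm (g (x0 + s))"
    using \<tau> alpha_less_1[of 1] alpha_pos[of 1] by (intro mult_mono) auto
  moreover have "1 / \<tau> * norm (g (x0 + s)) \<le> 87 / 50 * R" by (rule bds(3)) auto
  ultimately have "1 / \<tau> * alpha 1 * norm (g (x0 + s)) \<le> 87 / 50 * R" by linarith
  moreover have "x0 + s \<in> Rd d" "x0 - (1 / \<tau>) *\<^sub>R g (x0 + s) \<in> Rd d"
    using x0 s by (auto intro!: Rd_closed g_Rd)
  ultimately show ?thesis unfolding npe_inv_def using bds(1,2) \<tau> by auto
qed

text \<open>With \<open>\<eta> = \<alpha> R\<close>, all points that matter lie within \<open>(79/25 + 3) \<eta> = 154/25 \<eta>\<close> of \<open>w\<close>, and \<open>\<alpha> \<le> 1 / \<surd>p\<close>. The three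
  conditions on \<open>p\<close> bound separate parts of the Hessian error: the approximation error by \<open>\<tau>/8\<close>, the part with \<open>M0\<close>
  through \<open>M0 \<eta> \<le> \<tau>/40\<close>, and the part with \<open>M1\<close> through the gradient bound of the invariant and \<open>64 M1 R\<^sup>2 \<le> B\<^sup>2 \<le> p\<close>.
  The same lower bound \<open>B\<^sup>2 \<le> p\<close> keeps these points in the region where the smoothness inequality is available.\<close>

lemma npe_accepts:
  assumes G: "npe_inv w z A P" and p: "P \<le> p" "p = A * \<tau>"
    and B: "B\<^sup>2 \<le> p" and \<delta>: "8 * \<delta> \<le> \<tau>" and M: "40 * M0 * R * A \<le> p * sqrt p"
  shows "\<exists>s. accepts d g (H w) (npe_v w z A \<tau>) \<tau> s"
proof -
  have A: "0 < A" and p1: "1 \<le> p" and P1: "1 \<le> P" and w: "w \<in> Rd d" and z: "z \<in> Rd d"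
    using G p by (auto simp: npe_inv_def)
  have \<tau>: "0 < \<tau>" using A p p1 by (metis less_le_trans zero_less_mult_pos zero_less_one)
  have \<tau>_eq: "\<tau> = p / A" using A p(2) by simp
  have al: "0 < alpha p" "alpha p < 1" "p * (alpha p)\<^sup>2 = 1 - alpha p"
    using p1 alpha_pos[of p] alpha_less_1[of p] alpha_sq[of p] by auto
  define \<eta> where "\<eta> = alpha p * R"
  have \<eta>: "0 < \<eta>" using al R_pos by (simp add: \<eta>_def)
  define v where "v = npe_v w z A \<tau>"
  have v: "v = (1 - alpha p) *\<^sub>R w + alpha p *\<^sub>R z"
    by (simp add: v_def npe_v_def npe_alpha_eq p(2))
  have vR: "v \<in> Rd d" unfolding v_def by (rule npe_v_Rd[OF w z])
  define h0 where "h0 = alpha p *\<^sub>R (xs - z)"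
  have h0R: "h0 \<in> Rd d" unfolding h0_def by (intro Rd_closed xs z)
  have zR: "norm (xs - z) \<le> R" using npe_inv_z[OF G] by (simp add: norm_minus_commute)
  have h0_le: "norm h0 \<le> \<eta>" using zR al by (simp add: h0_def \<eta>_def)
  have gap: "f (v + h0) + \<tau> / 2 * (norm h0)\<^sup>2 \<le> f xs + \<tau> / 2 * \<eta>\<^sup>2"
  proof -
    have "v + h0 = (1 - alpha p) *\<^sub>R w + alpha p *\<^sub>R xs" by (simp add: v h0_def algebra_simps)
    then have "f (v + h0) \<le> (1 - alpha p) * f w + alpha p * f xs"
      using convex_onD[OF convex, of "alpha p" w xs] al w xs by simp
    then have "f (v + h0) - f xs \<le> (1 - alpha p) * (f w - f xs)" by (simp add: algebra_simps)
    also have "\<dots> = \<tau> * (alpha p)\<^sup>2 * (A * (f w - f xs))"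
      using al(3) by (simp add: p(2) mult_ac)
    finally have "f (v + h0) - f xs \<le> \<tau> * (alpha p)\<^sup>2 * (A * (f w - f xs))" .
    moreover have "(norm h0)\<^sup>2 = (alpha p)\<^sup>2 * (norm (z - xs))\<^sup>2"
      by (simp add: h0_def power_mult_distrib norm_minus_commute)
    ultimately have "f (v + h0) - f xs + \<tau> / 2 * (norm h0)\<^sup>2
        \<le> \<tau> * (alpha p)\<^sup>2 * (A * (f w - f xs) + (norm (z - xs))\<^sup>2 / 2)"
      by (simp add: distrib_left mult.assoc)
    also have "\<dots> \<le> \<tau> * (alpha p)\<^sup>2 * (R\<^sup>2 / 2)"
      using G \<tau> by (intro mult_left_mono) (auto simp: npe_inv_def)
    finally show ?thesis by (simp add: \<eta>_def power_mult_distrib)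
  qed
  have vw: "norm (v - w) \<le> 79 / 25 * \<eta>"
  proof -
    have "v - w = alpha p *\<^sub>R ((z - xs) - (w - xs))" by (simp add: v algebra_simps)
    moreover have "norm ((z - xs) - (w - xs)) \<le> R + 54 / 25 * R"
      using norm_triangle_ineq4[of "z - xs" "w - xs"] npe_inv_z[OF G] G by (simp add: npe_inv_def)
    ultimately show ?thesis using al by (simp add: \<eta>_def)
  qed
  have L\<eta>: "gen_L g M0 M1 w * (154 / 25 * \<eta>) \<le> 13 / 40 * \<tau>"
  proof -
    have "alpha p \<le> 1 / sqrt p" by (rule alpha_le_inverse) (use p1 in auto)
    then have "M0 * \<eta> \<le> M0 * R / sqrt p"
      using mult_left_mono[of "alpha p" "1 / sqrt p" "M0 * R"] M0 R_pos by (simp add: \<eta>_def mult_ac)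
    also have "\<dots> \<le> \<tau> / 40"
      using M A p1 by (simp add: \<tau>_eq field_simps)
    finally have 1: "M0 * \<eta> \<le> \<tau> / 40" .
    have "A * (alpha p * norm (g w)) \<le> A * (alpha P * norm (g w))"
      using A alpha_antimono[of P p] P1 p by (intro mult_left_mono mult_right_mono) auto
    also have "\<dots> \<le> 87 / 50 * R" using G by (simp add: npe_inv_def mult.assoc)
    finally have "M1 * R * (A * (alpha p * norm (g w))) \<le> M1 * R * (87 / 50 * R)"
      using M1 R_pos by (intro mult_left_mono) auto
    also have "\<dots> = 87 / 3200 * (64 * M1 * R\<^sup>2)" by (simp add: power2_eq_square)
    also have "\<dots> \<le> 87 / 3200 * p" using B_ge_M1 B by simp
    finally have "A * (M1 * norm (g w) * \<eta>) \<le> A * (87 / 3200 * \<tau>)"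
      by (simp add: \<eta>_def p(2) mult_ac)
    then have 2: "M1 * norm (g w) * \<eta> \<le> 87 / 3200 * \<tau>" using A by simp
    have "gen_L g M0 M1 w * (154 / 25 * \<eta>) = 154 / 25 * (M0 * \<eta> + M1 * norm (g w) * \<eta>)"
      by (simp add: gen_L_def algebra_simps)
    also have "\<dots> \<le> 154 / 25 * (\<tau> / 40 + 87 / 3200 * \<tau>)" using 1 2 by simp
    also have "\<dots> \<le> 13 / 40 * \<tau>" using \<tau> by simp
    finally show ?thesis .
  qed
  have close: "norm (D (v + h) - H w) \<le> 9 / 20 * \<tau>" if h: "h \<in> Rd d" "norm h \<le> 3 * \<eta>" for h
  proof -
    have "norm (v + h - w) \<le> norm (v - w) + norm h"
      using norm_triangle_ineq[of "v - w" h] by (simp add: algebra_simps)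
    then have d: "norm (v + h - w) \<le> 154 / 25 * \<eta>" using vw h(2) by simp
    have "alpha p \<le> 1 / B" using B B_ge_1 by (intro alpha_le_inverse) auto
    then have "alpha p * R \<le> 1 / B * R" using R_pos by (intro mult_right_mono) auto
    then have "\<eta> \<le> R / B" by (simp add: \<eta>_def)
    then have "ereal (norm (v + h - w)) \<le> \<rho>" using d \<eta> by (intro within_radius) simp
    then have "norm (D (v + h) - D w) \<le> gen_L g M0 M1 w * norm (v + h - w)"
      by (intro hess_smooth w Rd_add vR h)
    also have "\<dots> \<le> gen_L g M0 M1 w * (154 / 25 * \<eta>)"
      using M0 M1 d by (intro mult_left_mono) (auto simp: gen_L_def)
    also note L\<eta>
    finally have "norm (D (v + h) - D w) \<le> 13 / 40 * \<tau>" .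
    moreover have "norm (D w - H w) \<le> \<tau> / 8"
      using H_err[OF w] \<delta> by (simp add: norm_minus_commute)
    ultimately show ?thesis
      using norm_triangle_ineq[of "D (v + h) - D w" "D w - H w"] by simp
  qed
  show ?thesis
    unfolding v_def[symmetric]
    by (rule accepts_if_hessian_close[OF H_sym[OF w] vR h0R h0_le \<eta> \<tau> minimizer gap close])
qed

text \<open>At \<open>x0\<close> no potential is available yet, but the step is explicitly bounded by \<open>4/3 |g x0| / \<tau>\<close>.\<close>

lemma start_accepts:
  assumes \<tau>: "0 < \<tau>" "4 * \<delta> \<le> \<tau>" "4 * (gen_L g M0 M1 x0 * norm (g x0)) \<le> \<tau>\<^sup>2"
    "ereal (2 * norm (g x0) / \<tau>) \<le> \<rho>"
  shows "\<exists>s. accepts d g (H x0) x0 \<tau> s"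
proof -
  define T where "T = blinfun_apply (H x0 + \<tau> *\<^sub>R id_blinfun)"
  have T: "T u = blinfun_apply (H x0) u + \<tau> *\<^sub>R u" for u
    by (simp add: T_def blinfun.add_left blinfun.scaleR_left)
  have T_coercive: "3 / 4 * \<tau> * (norm u)\<^sup>2 \<le> inner (T u) u" if u: "u \<in> Rd d" for u
  proof -
    have "norm (D x0 - H x0) \<le> \<tau> / 4"
      using H_err[OF x0] \<tau> by (simp add: norm_minus_commute)
    from abs_le_D1[OF inner_blinfun_bound[OF this, of u u]] hess_psd[OF x0 u]
    show ?thesis by (simp add: T inner_add_left blinfun.diff_left inner_diff_left
          dot_square_norm power2_eq_square mult.assoc)
  qed
  have pd: "pos_def d (H x0 + \<tau> *\<^sub>R id_blinfun)"
    unfolding pos_def_def T_def[symmetric]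
  proof (intro ballI impI)
    fix u :: rvec assume u: "u \<in> Rd d" "u \<noteq> 0"
    then have "0 < 3 / 4 * \<tau> * (norm u)\<^sup>2" using \<tau> by simp
    then show "0 < inner (T u) u" using T_coercive[OF u(1)] by simp
  qed
  have Hm: "H x0 \<in> mats d" using H_sym[OF x0] by (simp add: sym_mats_def)
  obtain s where s: "s \<in> Rd d" "T s = - g x0"
    using pos_def_solvable[OF Hm pd Rd_neg[OF g_Rd[OF x0]]] unfolding T_def by blast
  have "3 / 4 * \<tau> * (norm s)\<^sup>2 \<le> norm (g x0) * norm s"
    using T_coercive[OF s(1)] norm_cauchy_schwarz[of "T s" s] s(2) by simp
  then have "norm s * (3 / 4 * \<tau> * norm s) \<le> norm s * norm (g x0)"
    by (simp add: power2_eq_square mult_ac)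
  then have s_le: "3 / 4 * \<tau> * norm s \<le> norm (g x0)"
    by (cases "s = 0") (auto simp: mult_le_cancel_left)
  define L where "L = gen_L g M0 M1 x0"
  have L: "0 \<le> L" using M0 M1 by (simp add: L_def gen_L_def)
  have "norm (g (x0 + s) - g x0 - blinfun_apply (H x0) s) \<le> (\<tau> / 4 + L * norm s / 2) * norm s"
  proof (rule newton_residual[OF x0 s(1)])
    fix t :: real assume t: "0 \<le> t" "t \<le> 1"
    have ts: "norm (x0 + t *\<^sub>R s - x0) = t * norm s" using t by simp
    have "t * norm s \<le> 1 * norm s" using t by (intro mult_right_mono) auto
    also have "1 * norm s \<le> 2 * norm (g x0) / \<tau>" 
    proof -
      have "\<tau> * norm s \<le> 2 * norm (g x0)" using s_le norm_ge_zero[of "g x0"] by linarith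
      then show ?thesis using \<tau>(1) by (simp add: field_simps)
    qed
    finally have "ereal (norm (x0 + t *\<^sub>R s - x0)) \<le> \<rho>"
      unfolding ts using \<tau>(4) by (metis ereal_less_eq(3) order_trans)
    then have "norm (D (x0 + t *\<^sub>R s) - D x0) \<le> L * norm (x0 + t *\<^sub>R s - x0)"
      unfolding L_def by (intro hess_smooth x0 line_Rd s)
    then have "norm (D (x0 + t *\<^sub>R s) - D x0) \<le> L * norm s * t" unfolding ts by (simp add: mult_ac)
    moreover have "norm (D x0 - H x0) \<le> \<tau> / 4"
      using H_err[OF x0] \<tau>(2) by (simp add: norm_minus_commute)
    ultimately show "norm (D (x0 + t *\<^sub>R s) - H x0) \<le> \<tau> / 4 + L * norm s * t"
      using norm_triangle_ineq[of "D (x0 + t *\<^sub>R s) - D x0" "D x0 - H x0"] by simp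
  qed
  moreover have "g (x0 + s) - g x0 - blinfun_apply (H x0) s = g (x0 + s) + \<tau> *\<^sub>R s"
    using s(2) by (simp add: T algebra_simps eq_neg_iff_add_eq_0)
  moreover have "(\<tau> / 4 + L * norm s / 2) * norm s \<le> \<tau> / 2 * norm s"
  proof (intro mult_right_mono)
    have "L * (3 / 4 * \<tau> * norm s) \<le> L * norm (g x0)" using s_le L by (rule mult_left_mono)
    also have "\<dots> \<le> \<tau> * (\<tau> / 4)" using \<tau>(3) by (simp add: L_def power2_eq_square)
    finally have "\<tau> * (L * norm s) \<le> \<tau> * (\<tau> / 3)" by (simp add: mult_ac)
    then show "\<tau> / 4 + L * norm s / 2 \<le> \<tau> / 2" using \<tau>(1) by simp
  qed simp
  ultimately have "norm (g (x0 + s) + \<tau> *\<^sub>R s) \<le> \<tau> / 2 * norm s" by simp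
  then show ?thesis unfolding accepts_def using pd s unfolding T_def by blast
qed

end


section \<open>Backtracking and existence of a run\<close>

lemma MSBacktrack_D:
  assumes "MSBacktrack d g H x \<tau> x' \<tau>' j"
  shows "(\<exists>s. accepts d g (H x) x \<tau>' s \<and> x' = x + s) \<and> \<tau>' = 2 ^ j * \<tau> \<and>
         (\<forall>i<j. \<nexists>s. accepts d g (H x) x (2 ^ i * \<tau>) s)"
  using assms
proof induction
  case (reject \<tau> x' \<tau>' j)
  have "\<nexists>s. accepts d g (H x) x (2 ^ i * \<tau>) s" if "i < Suc j" for i
    using reject that by (cases i) (auto simp: mult_ac)
  then show ?case using reject by (auto simp: mult_ac)
qed auto

lemma MSBacktrack_exists:
  "\<exists>s. accepts d g (H x) x (2 ^ n * \<tau>) s \<Longrightarrow> \<exists>x' \<tau>' j. MSBacktrack d g H x \<tau> x' \<tau>' j"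
proof (induction n arbitrary: \<tau>)
  case 0
  then show ?case by (auto intro: MSBacktrack.accept)
next
  case (Suc n)
  show ?case
  proof (cases "\<exists>s. accepts d g (H x) x \<tau> s")
    case False
    have "\<exists>x' \<tau>' j. MSBacktrack d g H x (2 * \<tau>) x' \<tau>' j"
      using Suc.prems by (intro Suc.IH) (simp add: mult_ac)
    then show ?thesis using False by (blast intro: MSBacktrack.reject)
  qed (blast intro: MSBacktrack.accept)
qed

lemma NPE_step_D:
  assumes "NPE_step d g H w z A \<tau> w' z' A' \<tau>' j"
  shows "(\<exists>s. accepts d g (H w) (npe_v w z A (2 ^ j * \<tau>)) (2 ^ j * \<tau>) s \<and>
              w' = npe_v w z A (2 ^ j * \<tau>) + s) \<and>
         A' = A / (1 - npe_alpha A (2 ^ j * \<tau>)) \<and>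
         z' = z - (npe_alpha A (2 ^ j * \<tau>) * A') *\<^sub>R g w' \<and>
         \<tau>' = (1 - npe_alpha A (2 ^ j * \<tau>)) * (2 ^ j * \<tau>) \<and>
         (\<forall>i<j. \<nexists>s. accepts d g (H w) (npe_v w z A (2 ^ i * \<tau>)) (2 ^ i * \<tau>) s)"
  using assms
proof induction
  case (reject \<tau> w' z' A' \<tau>' j)
  have "\<nexists>s. accepts d g (H w) (npe_v w z A (2 ^ i * \<tau>)) (2 ^ i * \<tau>) s" if "i < Suc j" for i
    using reject that by (cases i) (auto simp: mult_ac)
  moreover have "2 ^ Suc j * \<tau> = 2 ^ j * (2 * \<tau>)" by simp
  ultimately show ?case using reject.IH by metis
qed auto

lemma NPE_step_accepted:
  "\<exists>s. accepts d g (H w) (npe_v w z A \<tau>) \<tau> s \<Longrightarrow> \<exists>w' z' A' \<tau>' j. NPE_step d g H w z A \<tau> w' z' A' \<tau>' j"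
  by (elim exE, intro exI) (rule NPE_step.accept[OF _ refl refl refl refl refl])

lemma NPE_step_exists:
  "\<exists>s. accepts d g (H w) (npe_v w z A (2 ^ n * \<tau>)) (2 ^ n * \<tau>) s \<Longrightarrow>
   \<exists>w' z' A' \<tau>' j. NPE_step d g H w z A \<tau> w' z' A' \<tau>' j"
proof (induction n arbitrary: \<tau>)
  case 0
  then show ?case by (intro NPE_step_accepted) simp
next
  case (Suc n)
  show ?case
  proof (cases "\<exists>s. accepts d g (H w) (npe_v w z A \<tau>) \<tau> s")
    case False
    have "\<exists>w' z' A' \<tau>' j. NPE_step d g H w z A (2 * \<tau>) w' z' A' \<tau>' j"
      using Suc.prems by (intro Suc.IH) (simp add: mult_ac)
    then show ?thesis using False by (blast intro: NPE_step.reject)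
  qed (rule NPE_step_accepted)
qed

text \<open>A count of doublings is read off from the last rejected value.\<close>

lemma doublings_le:
  assumes "1 \<le> T" "j \<noteq> 0 \<Longrightarrow> 2 ^ (j - 1) < T"
  shows "int j \<le> \<lceil>log 2 T\<rceil>"
proof (cases j)
  case 0
  have "0 \<le> log 2 T" using assms(1) by simp
  then show ?thesis using 0 by simp
next
  case (Suc i)
  then have "2 powr real i < T" using assms(2) by (simp add: powr_realpow)
  then have "real i < log 2 T" using assms(1) by (subst less_log_iff) auto
  then show ?thesis using Suc by linarith
qed

lemma root3_powr:
  assumes "0 \<le> x"
  shows "x powr (1 / 3) = root 3 x" "x powr (2 / 3) = (root 3 x)\<^sup>2"
proof -
  show 1: "x powr (1 / 3) = root 3 x"
    using assms root_powr_inverse[of 3 x] by (cases "x = 0") auto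
  have "x powr (2 / 3) = (x powr (1 / 3))\<^sup>2"
    by (simp add: power2_eq_square flip: powr_add)
  then show "x powr (2 / 3) = (root 3 x)\<^sup>2" unfolding 1 .
qed

context npe_problem
begin

text \<open>One iteration in terms of \<open>p = A \<tau>\<close>: the number of rejections only enters through the factor \<open>2\<^sup>j\<close>.\<close>

lemma NPE_step_inv:
  assumes G: "npe_inv w z A (A * \<tau>)" and st: "NPE_step d g H w z A \<tau> w' z' A' \<tau>' j"
  shows "npe_inv w' z' A' (A' * \<tau>')" and "A' * \<tau>' = 2 ^ j * (A * \<tau>)"
    and "A' = A / (1 - alpha (A' * \<tau>'))"
    and "i < j \<Longrightarrow> \<not> (B\<^sup>2 \<le> 2 ^ i * (A * \<tau>) \<and> 8 * \<delta> \<le> 2 ^ i * \<tau> \<and>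
           40 * M0 * R * A \<le> 2 ^ i * (A * \<tau>) * sqrt (2 ^ i * (A * \<tau>)))"
proof -
  let ?p = "A * (2 ^ j * \<tau>)"
  have A: "0 < A" and p1: "1 \<le> A * \<tau>" using G by (auto simp: npe_inv_def)
  have grow: "A * \<tau> \<le> A * (2 ^ i * \<tau>)" for i
  proof -
    have "1 * (A * \<tau>) \<le> 2 ^ i * (A * \<tau>)" using p1 by (intro mult_right_mono) auto
    then show ?thesis by (simp add: mult_ac)
  qed
  have "1 \<le> ?p" using p1 grow by (rule order_trans)
  then have al: "alpha ?p < 1" using alpha_less_1[of ?p] by simp
  note S = NPE_step_D[OF st, unfolded npe_alpha_eq]
  from S obtain s where s: "accepts d g (H w) (npe_v w z A (2 ^ j * \<tau>)) (2 ^ j * \<tau>) s"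
    "w' = npe_v w z A (2 ^ j * \<tau>) + s" by blast
  have A': "A' = A / (1 - alpha ?p)" and \<tau>': "\<tau>' = (1 - alpha ?p) * (2 ^ j * \<tau>)"
    and z': "z' = z - (alpha ?p * A') *\<^sub>R g w'" using S by auto
  have p': "A' * \<tau>' = ?p" using al by (simp add: A' \<tau>')
  show "npe_inv w' z' A' (A' * \<tau>')"
    unfolding p' using npe_inv_step[OF G grow refl s(1)] by (simp only: s(2) A' z')
  show "A' * \<tau>' = 2 ^ j * (A * \<tau>)" unfolding p' by (simp add: mult_ac)
  show "A' = A / (1 - alpha (A' * \<tau>'))" unfolding p' by (rule A')
  assume "i < j"
  then have "\<nexists>s. accepts d g (H w) (npe_v w z A (2 ^ i * \<tau>)) (2 ^ i * \<tau>) s" using S by blast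
  moreover have "A * (2 ^ i * \<tau>) = 2 ^ i * (A * \<tau>)" by (simp add: mult_ac)
  ultimately show "\<not> (B\<^sup>2 \<le> 2 ^ i * (A * \<tau>) \<and> 8 * \<delta> \<le> 2 ^ i * \<tau> \<and>
           40 * M0 * R * A \<le> 2 ^ i * (A * \<tau>) * sqrt (2 ^ i * (A * \<tau>)))"
    using npe_accepts[OF G grow refl, of i] by metis
qed

lemma NPE_step_terminates:
  assumes G: "npe_inv w z A (A * \<tau>)"
  shows "\<exists>w' z' A' \<tau>' j. NPE_step d g H w z A \<tau> w' z' A' \<tau>' j"
proof -
  have A: "0 < A" and p1: "1 \<le> A * \<tau>" using G by (auto simp: npe_inv_def)
  have \<tau>: "0 < \<tau>" using A p1 by (metis less_le_trans zero_less_mult_pos zero_less_one)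
  obtain n where n: "B\<^sup>2 / (A * \<tau>) + 8 * \<delta> / \<tau> + 40 * M0 * R / \<tau> < 2 ^ n"
    using real_arch_pow[of 2] by auto
  have nonneg: "0 \<le> B\<^sup>2 / (A * \<tau>)" "0 \<le> 8 * \<delta> / \<tau>" "0 \<le> 40 * M0 * R / \<tau>"
    using A \<tau> \<delta>_nonneg M0 R_pos by auto
  have b: "B\<^sup>2 / (A * \<tau>) \<le> 2 ^ n" "8 * \<delta> / \<tau> \<le> 2 ^ n" "40 * M0 * R / \<tau> \<le> 2 ^ n"
    using n nonneg by linarith+
  let ?p = "A * (2 ^ n * \<tau>)"
  have "1 * (A * \<tau>) \<le> 2 ^ n * (A * \<tau>)" using p1 by (intro mult_right_mono) auto
  then have p: "A * \<tau> \<le> ?p" by (simp add: mult_ac)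
  have 1: "B\<^sup>2 \<le> ?p" using b(1) A \<tau> by (simp add: field_simps)
  have 2: "8 * \<delta> \<le> 2 ^ n * \<tau>" using b(2) \<tau> by (simp add: field_simps)
  have "40 * M0 * R \<le> 2 ^ n * \<tau>" using b(3) \<tau> by (simp add: field_simps)
  then have "40 * M0 * R * A \<le> ?p" using mult_left_mono[of "40 * M0 * R" "2 ^ n * \<tau>" A] A by (simp add: mult_ac)
  also have "?p \<le> ?p * sqrt ?p"
    using p p1 mult_left_mono[of 1 "sqrt ?p" ?p] by simp
  finally show ?thesis
    using npe_accepts[OF G p refl 1 2] by (intro NPE_step_exists[of d g H w z A n]) blast
qed

lemma run_exists:
  assumes \<tau>0: "0 < \<tau>0"
  shows "\<exists>w z A \<tau> r. A_NPE_run d g H x0 \<tau>0 w z A \<tau> r"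
proof -
  have "\<exists>n. \<exists>s. accepts d g (H x0) x0 (2 ^ n * \<tau>0) s"
  proof -
    define L where "L = gen_L g M0 M1 x0 * norm (g x0)"
    have L: "0 \<le> L" using M0 M1 by (simp add: L_def gen_L_def)
    obtain q where q: "0 < q" "ereal q \<le> \<rho>"
      using within_radius[OF order_refl] R_pos B_ge_1 by (metis divide_pos_pos less_le_trans mult_pos_pos zero_less_numeral zero_less_one)
    obtain n where n: "4 * \<delta> / \<tau>0 + (1 + 4 * L) / \<tau>0 + 2 * norm (g x0) / (q * \<tau>0) < 2 ^ n"
      using real_arch_pow[of 2] by auto
    have nonneg: "0 \<le> 4 * \<delta> / \<tau>0" "0 \<le> (1 + 4 * L) / \<tau>0" "0 \<le> 2 * norm (g x0) / (q * \<tau>0)"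
      using \<delta>_nonneg L q \<tau>0 by auto
    have b: "4 * \<delta> / \<tau>0 \<le> 2 ^ n" "(1 + 4 * L) / \<tau>0 \<le> 2 ^ n" "2 * norm (g x0) / (q * \<tau>0) \<le> 2 ^ n"
      using n nonneg by linarith+
    let ?t = "2 ^ n * \<tau>0"
    have t: "0 < ?t" "4 * \<delta> \<le> ?t" "1 + 4 * L \<le> ?t" using b(1,2) \<tau>0 by (simp_all add: field_simps)
    have "1 + 4 * L \<le> ?t * ?t"
      using mult_left_mono[of 1 ?t ?t] t L by linarith
    then have t2: "4 * L \<le> ?t\<^sup>2" by (simp add: power2_eq_square)
    have "2 * norm (g x0) / ?t \<le> q" using b(3) q(1) \<tau>0 by (simp add: field_simps)
    then have "ereal (2 * norm (g x0) / ?t) \<le> \<rho>" using q(2) by (metis ereal_less_eq(3) order_trans)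
    from start_accepts[OF t(1,2) t2[unfolded L_def] this] show ?thesis by blast
  qed
  then obtain x' \<tau>1 j where init: "MSBacktrack d g H x0 \<tau>0 x' \<tau>1 j"
    using MSBacktrack_exists by blast
  from MSBacktrack_D[OF init] obtain s where s: "accepts d g (H x0) x0 \<tau>1 s" "x' = x0 + s"
    and \<tau>1: "\<tau>1 = 2 ^ j * \<tau>0" by blast
  have \<tau>1_pos: "0 < \<tau>1" using \<tau>0 by (simp add: \<tau>1)
  \<comment> \<open>A state records \<open>w, z, A, \<tau>\<close> and the number of trials rejected on the way to it; state \<open>n\<close> belongs to iteration \<open>n + 1\<close>.\<close>
  define S0 where "S0 = (x', x0 - (1 / \<tau>1) *\<^sub>R g x', 1 / \<tau>1, \<tau>1, j)"
  define ok where "ok = (\<lambda>(n::nat) (w, z, A, \<tau>, r::nat). npe_inv w z A (A * \<tau>) \<and> (n = 0 \<longrightarrow> (w, z, A, \<tau>, r) = S0))"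
  define next_st where "next_st = (\<lambda>(n::nat) (w, z, A, \<tau>, r::nat) (w', z', A', \<tau>', r').
     NPE_step d g H w z A \<tau> w' z' A' \<tau>' r')"
  have "\<exists>F. \<forall>n. ok n (F n) \<and> next_st n (F n) (F (Suc n))"
  proof (rule dependent_nat_choice)
    show "\<exists>x. ok 0 x"
      using npe_inv_start[OF \<tau>1_pos s(1)] \<tau>1_pos
      by (intro exI[of _ S0]) (simp add: ok_def S0_def s(2))
    show "\<exists>y. ok (Suc n) y \<and> next_st n x y" if "ok n x" for x n
    proof -
      obtain w z A \<tau> r where x: "x = (w, z, A, \<tau>, r)" by (cases x) auto
      have G: "npe_inv w z A (A * \<tau>)" using that by (simp add: ok_def x)
      obtain w' z' A' \<tau>' j where st: "NPE_step d g H w z A \<tau> w' z' A' \<tau>' j"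
        using NPE_step_terminates[OF G] by blast
      show ?thesis
        using st NPE_step_inv(1)[OF G st]
        by (intro exI[of _ "(w', z', A', \<tau>', j)"]) (simp add: ok_def next_st_def x)
    qed
  qed
  then obtain F where F: "\<And>n. ok n (F n)" "\<And>n. next_st n (F n) (F (Suc n))" by blast
  define w where "w = (\<lambda>k. fst (F (k - 1)))"
  define z where "z = (\<lambda>k. fst (snd (F (k - 1))))"
  define A where "A = (\<lambda>k. fst (snd (snd (F (k - 1)))))"
  define \<tau> where "\<tau> = (\<lambda>k. fst (snd (snd (snd (F (k - 1))))))"
  define r where "r = (\<lambda>k. snd (snd (snd (snd (F k)))))"
  have F0: "F 0 = S0" using F(1)[of 0] by (auto simp: ok_def split: prod.splits)
  have "NPE_step d g H (w k) (z k) (A k) (\<tau> k) (w (Suc k)) (z (Suc k)) (A (Suc k)) (\<tau> (Suc k)) (r k)"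
    if "1 \<le> k" for k
    using F(2)[of "k - 1"] that
    by (auto simp: next_st_def w_def z_def A_def \<tau>_def r_def split: prod.splits)
  moreover have "MSBacktrack d g H x0 \<tau>0 (w 1) (\<tau> 1) (r 0)" "A 1 = 1 / \<tau> 1" "z 1 = x0 - A 1 *\<^sub>R g (w 1)"
    using init by (simp_all add: w_def z_def A_def \<tau>_def r_def F0 S0_def)
  ultimately have "A_NPE_run d g H x0 \<tau>0 w z A \<tau> r" by (simp add: A_NPE_run_def)
  then show ?thesis by blast
qed

section \<open>Growth of the weights\<close>

text \<open>The acceptance threshold for \<open>p\<close> in terms of the weight \<open>a\<close> alone is the square of \<open>max B (psi a)\<close>. Its two terms scale
  like \<open>a\<^bsup>1/3\<^esup>\<close> and \<open>a\<^bsup>1/2\<^esup>\<close>, and they dominate in the regimes governed by \<open>M0\<close> and by \<open>\<delta>\<close>.\<close>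

definition psi :: "real \<Rightarrow> real" where
  "psi a = max (root 3 (40 * M0 * R * a)) (sqrt (8 * \<delta> * a))"

lemma psi_mono: "a \<le> b \<Longrightarrow> psi a \<le> psi b"
  unfolding psi_def using M0 R_pos \<delta>_nonneg
  by (intro max.mono) (auto intro!: mult_left_mono)

lemma psi_le_iff:
  assumes "0 \<le> \<Theta>"
  shows "psi a \<le> \<Theta> \<longleftrightarrow> 40 * M0 * R * a \<le> \<Theta> ^ 3 \<and> 8 * \<delta> * a \<le> \<Theta>\<^sup>2"
proof -
  have "root 3 (40 * M0 * R * a) \<le> \<Theta> \<longleftrightarrow> root 3 (40 * M0 * R * a) \<le> root 3 (\<Theta> ^ 3)"
    using assms by (simp add: real_root_power_cancel)
  moreover have "sqrt (8 * \<delta> * a) \<le> \<Theta> \<longleftrightarrow> sqrt (8 * \<delta> * a) \<le> sqrt (\<Theta>\<^sup>2)"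
    using assms by simp
  ultimately show ?thesis by (simp only: psi_def max.bounded_iff real_root_le_iff real_sqrt_le_iff zero_less_numeral)
qed

text \<open>The threshold \<open>\<epsilon>\<^sub>t\<^sub>r\<close> is where \<open>B\<close> stops dominating \<open>psi\<close>.\<close>

lemma psi_le_B_iff: "psi a \<le> B \<longleftrightarrow> 2 * a * eps_tr M0 \<delta> R B \<le> R\<^sup>2" if a: "0 \<le> a"
proof -
  have B: "0 < B" using B_ge_1 by simp
  have R2: "0 < R\<^sup>2" using R_pos by simp
  have "2 * a * eps_tr M0 \<delta> R B = max (2 * a * (20 * M0 * R ^ 3 / B ^ 3)) (2 * a * (4 * \<delta> * R\<^sup>2 / B\<^sup>2))"
    unfolding eps_tr_def using a by (simp add: max_mult_distrib_left)
  moreover have "2 * a * (20 * M0 * R ^ 3 / B ^ 3) \<le> R\<^sup>2 \<longleftrightarrow> 40 * M0 * R * a \<le> B ^ 3"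
  proof -
    have "2 * a * (20 * M0 * R ^ 3 / B ^ 3) \<le> R\<^sup>2 \<longleftrightarrow> R\<^sup>2 * (40 * M0 * R * a) \<le> R\<^sup>2 * B ^ 3"
      using B by (simp add: field_simps power2_eq_square power3_eq_cube)
    then show ?thesis by (simp only: mult_le_cancel_left_pos[OF R2])
  qed
  moreover have "2 * a * (4 * \<delta> * R\<^sup>2 / B\<^sup>2) \<le> R\<^sup>2 \<longleftrightarrow> 8 * \<delta> * a \<le> B\<^sup>2"
  proof -
    have "2 * a * (4 * \<delta> * R\<^sup>2 / B\<^sup>2) \<le> R\<^sup>2 \<longleftrightarrow> R\<^sup>2 * (8 * \<delta> * a) \<le> R\<^sup>2 * B\<^sup>2"
      using B by (simp add: field_simps)
    then show ?thesis by (simp only: mult_le_cancel_left_pos[OF R2])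
  qed
  ultimately show ?thesis using B by (simp add: psi_le_iff)
qed

text \<open>Both terms of \<open>psi\<close> are homogeneous of degree at least \<open>1/3\<close>, so that it suffices to have
  \<open>(1 + \<alpha>/3)\<^sup>3 (1 - \<alpha>) \<le> 1\<close>.\<close>

lemma psi_gain:
  assumes a: "0 \<le> a" and \<alpha>: "0 < \<alpha>" "\<alpha> < 1"
  shows "(1 + \<alpha> / 3) * psi a \<le> psi (a / (1 - \<alpha>))"
proof -
  let ?q = "1 / (1 - \<alpha>)"
  have "(1 + \<alpha> / 3) ^ 3 * (1 - \<alpha>) = 1 - (2 / 3 * \<alpha>\<^sup>2 + 8 / 27 * \<alpha> ^ 3 + \<alpha> ^ 4 / 27)"
    by (simp add: power2_eq_square power3_eq_cube power4_eq_xxxx field_simps)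
  also have "\<dots> \<le> 1"
  proof -
    have "0 \<le> 2 / 3 * \<alpha>\<^sup>2 + 8 / 27 * \<alpha> ^ 3 + \<alpha> ^ 4 / 27"
      using \<alpha> by (intro add_nonneg_nonneg) auto
    then show ?thesis by linarith
  qed
  finally have 3: "(1 + \<alpha> / 3) ^ 3 \<le> ?q" using \<alpha> by (simp add: field_simps)
  have "(1 + \<alpha> / 3)\<^sup>2 \<le> (1 + \<alpha> / 3) ^ 3" using \<alpha> by (intro power_increasing) auto
  then have 2: "(1 + \<alpha> / 3)\<^sup>2 \<le> ?q" using 3 by simp
  have "1 + \<alpha> / 3 = root 3 ((1 + \<alpha> / 3) ^ 3)" using \<alpha> by (simp add: real_root_power_cancel)
  also have "\<dots> \<le> root 3 ?q" using 3 by simp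
  finally have r3: "(1 + \<alpha> / 3) * root 3 (40 * M0 * R * a) \<le> root 3 ?q * root 3 (40 * M0 * R * a)"
    using M0 R_pos a by (intro mult_right_mono) auto
  have "1 + \<alpha> / 3 = sqrt ((1 + \<alpha> / 3)\<^sup>2)" using \<alpha> by simp
  also have "\<dots> \<le> sqrt ?q" using 2 by (rule real_sqrt_le_mono)
  finally have r2: "(1 + \<alpha> / 3) * sqrt (8 * \<delta> * a) \<le> sqrt ?q * sqrt (8 * \<delta> * a)"
    using \<delta>_nonneg a by (intro mult_right_mono) auto
  have e3: "root 3 ?q * root 3 (40 * M0 * R * a) = root 3 (40 * M0 * R * (a / (1 - \<alpha>)))"
    unfolding real_root_mult[symmetric] by (simp add: mult_ac)
  have e2: "sqrt ?q * sqrt (8 * \<delta> * a) = sqrt (8 * \<delta> * (a / (1 - \<alpha>)))"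
    unfolding real_sqrt_mult[symmetric] by (simp add: mult_ac)
  have "(1 + \<alpha> / 3) * psi a = max ((1 + \<alpha> / 3) * root 3 (40 * M0 * R * a)) ((1 + \<alpha> / 3) * sqrt (8 * \<delta> * a))"
    unfolding psi_def using \<alpha> by (simp add: max_mult_distrib_left)
  also have "\<dots> \<le> psi (a / (1 - \<alpha>))"
    unfolding psi_def using r3 r2 unfolding e3 e2 by (rule max.mono)
  finally show ?thesis .
qed

end

locale npe_run = npe_problem +
  fixes \<tau>0 :: real and w z :: "nat \<Rightarrow> rvec" and A \<tau> :: "nat \<Rightarrow> real" and r :: "nat \<Rightarrow> nat"
  assumes \<tau>0: "0 < \<tau>0" and run: "A_NPE_run d g H x0 \<tau>0 w z A \<tau> r"
begin

abbreviation p where "p k \<equiv> A k * \<tau> k"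

lemma step: "1 \<le> k \<Longrightarrow> NPE_step d g H (w k) (z k) (A k) (\<tau> k)
    (w (Suc k)) (z (Suc k)) (A (Suc k)) (\<tau> (Suc k)) (r k)"
  using run by (simp add: A_NPE_run_def)

lemma start: "npe_inv (w 1) (z 1) (A 1) (p 1)" and p_1: "p 1 = 1"
proof -
  have init: "MSBacktrack d g H x0 \<tau>0 (w 1) (\<tau> 1) (r 0)"
    and A1: "A 1 = 1 / \<tau> 1" and z1: "z 1 = x0 - A 1 *\<^sub>R g (w 1)"
    using run by (simp_all add: A_NPE_run_def)
  from MSBacktrack_D[OF init] obtain s where s: "accepts d g (H x0) x0 (\<tau> 1) s" "w 1 = x0 + s"
    and \<tau>1: "\<tau> 1 = 2 ^ r 0 * \<tau>0" by blast
  have \<tau>1_pos: "0 < \<tau> 1" using \<tau>0 \<tau>1 by simp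
  then show p1: "p 1 = 1" using A1 by simp
  show "npe_inv (w 1) (z 1) (A 1) (p 1)"
    unfolding p1 using npe_inv_start[OF \<tau>1_pos s(1)] by (simp only: s(2) z1 A1)
qed

lemma run_inv: "1 \<le> k \<Longrightarrow> npe_inv (w k) (z k) (A k) (p k)"
proof (induction k rule: nat_induct_at_least)
  case base
  show ?case by (rule start)
next
  case (Suc k)
  show ?case by (rule NPE_step_inv(1)[OF Suc.IH step[OF Suc.hyps]])
qed

lemma A_pos: "1 \<le> k \<Longrightarrow> 0 < A k" and p_ge_1: "1 \<le> k \<Longrightarrow> 1 \<le> p k"
  using run_inv by (auto simp: npe_inv_def)

lemma p_Suc: "1 \<le> k \<Longrightarrow> p (Suc k) = 2 ^ r k * p k"
  by (rule NPE_step_inv(2)[OF run_inv step])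

lemma A_Suc: "1 \<le> k \<Longrightarrow> A (Suc k) = A k / (1 - alpha (p (Suc k)))"
  by (rule NPE_step_inv(3)[OF run_inv step])

lemma alpha_run:
  assumes "1 \<le> k"
  shows "0 < alpha (p (Suc k))" "alpha (p (Suc k)) < 1"
  using p_ge_1[of "Suc k"] alpha_pos[of "p (Suc k)"] alpha_less_1[of "p (Suc k)"] by auto

lemma A_le_Suc: "1 \<le> k \<Longrightarrow> A k \<le> A (Suc k)"
  using A_pos[of k] alpha_run[of k] by (subst A_Suc) (auto simp: field_simps)

lemma A_mono: "1 \<le> k \<Longrightarrow> k \<le> l \<Longrightarrow> A k \<le> A l"
  by (rule dec_induct[of k l "\<lambda>l. A k \<le> A l"]) (use A_le_Suc in \<open>auto intro: order_trans\<close>)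

lemma rejected_p_less:
  assumes k: "1 \<le> k" and i: "i < r k" and \<Theta>: "B \<le> \<Theta>" "psi (A k) \<le> \<Theta>"
  shows "2 ^ i * p k < \<Theta>\<^sup>2"
proof (rule ccontr)
  assume n: "\<not> 2 ^ i * p k < \<Theta>\<^sup>2"
  define q where "q = 2 ^ i * p k"
  have q: "\<Theta>\<^sup>2 \<le> q" using n by (simp add: q_def)
  have A: "0 < A k" by (rule A_pos[OF k])
  have \<Theta>0: "0 \<le> \<Theta>" using \<Theta> B_ge_1 by simp
  have psi: "40 * M0 * R * A k \<le> \<Theta> ^ 3" "8 * \<delta> * A k \<le> \<Theta>\<^sup>2"
    using \<Theta> psi_le_iff[OF \<Theta>0] by auto
  have "B\<^sup>2 \<le> q" using power_mono[OF \<Theta>(1), of 2] B_ge_1 q by simp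
  moreover have "8 * \<delta> \<le> 2 ^ i * \<tau> k"
  proof -
    have "A k * (8 * \<delta>) \<le> A k * (2 ^ i * \<tau> k)" using psi(2) q by (simp add: q_def mult_ac)
    then show ?thesis using A by simp
  qed
  moreover have "40 * M0 * R * A k \<le> q * sqrt q"
  proof -
    have "\<Theta> \<le> sqrt q" using q \<Theta>0 by (simp add: real_le_rsqrt)
    moreover have "0 \<le> q" using q zero_le_power2[of \<Theta>] by linarith
    ultimately have "\<Theta>\<^sup>2 * \<Theta> \<le> q * sqrt q" using q \<Theta>0 by (intro mult_mono) auto
    then show ?thesis using psi(1) by (simp add: power2_eq_square power3_eq_cube)
  qed
  ultimately show False
    using NPE_step_inv(4)[OF run_inv[OF k] step[OF k] i] unfolding q_def by blast
qed

text \<open>Only the last rejection matters: the value rejected there was below the threshold, and it was doubled once.\<close>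

lemma p_after_rejections:
  assumes "1 \<le> N" and bd: "\<And>k. 1 \<le> k \<Longrightarrow> k < N \<Longrightarrow> psi (A k) \<le> \<Theta>" and \<Theta>: "B \<le> \<Theta>"
  shows "p N = 1 \<or> p N < 2 * \<Theta>\<^sup>2"
  using assms(1) bd
proof (induction N rule: nat_induct_at_least)
  case base
  show ?case using p_1 by simp
next
  case (Suc k)
  show ?case
  proof (cases "r k")
    case 0
    then show ?thesis using p_Suc[OF Suc.hyps] Suc by auto
  next
    case (Suc i)
    then have "2 ^ i * p k < \<Theta>\<^sup>2"
      using Suc.hyps Suc.prems \<Theta> by (intro rejected_p_less) auto
    then show ?thesis using p_Suc[OF Suc.hyps] Suc by simp
  qed
qed

lemma p_Suc_le:
  assumes k: "1 \<le> k"
  shows "p (Suc k) \<le> 2 * (max B (psi (A k)))\<^sup>2"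
proof -
  have "1 \<le> (max B (psi (A k)))\<^sup>2" using B_ge_1 by (simp add: le_max_iff_disj)
  moreover have "p (Suc k) = 1 \<or> p (Suc k) < 2 * (max B (psi (A k)))\<^sup>2"
  proof (rule p_after_rejections)
    fix i assume "1 \<le> i" "i < Suc k"
    then have "psi (A i) \<le> psi (A k)" by (intro psi_mono A_mono) auto
    then show "psi (A i) \<le> max B (psi (A k))" by simp
  qed auto
  ultimately show ?thesis by auto
qed

lemma alpha_run_ge:
  assumes k: "1 \<le> k"
  shows "1 / (2 * max B (psi (A k))) \<le> alpha (p (Suc k))"
  using p_ge_1[of "Suc k"] B_ge_1 p_Suc_le[OF k] by (intro alpha_ge) auto

lemma A_exponential:
  assumes "1 \<le> k" and "\<And>i. 1 \<le> i \<Longrightarrow> i < k \<Longrightarrow> psi (A i) \<le> B"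
  shows "A 1 * exp ((real k - 1) / (2 * B)) \<le> A k"
  using assms
proof (induction k rule: nat_induct_at_least)
  case base
  show ?case by simp
next
  case (Suc k)
  define \<alpha> where "\<alpha> = alpha (p (Suc k))"
  have \<alpha>: "0 < \<alpha>" "\<alpha> < 1" using alpha_run[OF Suc.hyps] by (auto simp: \<alpha>_def)
  have A_eq: "A (Suc k) = A k / (1 - \<alpha>)" unfolding \<alpha>_def by (rule A_Suc[OF Suc.hyps])
  have "max B (psi (A k)) = B" using Suc.prems[of k] Suc.hyps by simp
  then have \<alpha>_ge: "1 / (2 * B) \<le> \<alpha>" using alpha_run_ge[OF Suc.hyps] by (simp add: \<alpha>_def)
  have "1 - \<alpha> \<le> exp (- \<alpha>)" using exp_ge_add_one_self[of "- \<alpha>"] by simp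
  then have "exp \<alpha> \<le> 1 / (1 - \<alpha>)" using \<alpha> by (simp add: exp_minus field_simps)
  then have "exp (1 / (2 * B)) \<le> 1 / (1 - \<alpha>)" using \<alpha>_ge by (meson exp_le_cancel_iff order_trans)
  moreover have "A 1 * exp ((real k - 1) / (2 * B)) \<le> A k" using Suc by auto
  ultimately have "A 1 * exp ((real k - 1) / (2 * B)) * exp (1 / (2 * B)) \<le> A k * (1 / (1 - \<alpha>))"
    using A_pos[OF Suc.hyps] by (intro mult_mono) auto
  then show ?case
    unfolding A_eq by (simp add: mult.assoc add_divide_distrib[symmetric] flip: exp_add)
qed

text \<open>By the lower bound on \<open>\<alpha>\<close>, \<open>psi\<close> is multiplied by at least \<open>1 + 1 / (6 psi)\<close>.\<close>

lemma psi_linear: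
  assumes m: "1 \<le> m" and B: "B \<le> psi (A m)"
  shows "B + real n / 6 \<le> psi (A (m + n))"
proof (induction n)
  case 0
  show ?case using B by simp
next
  case (Suc n)
  let ?k = "m + n"
  have k: "1 \<le> ?k" using m by simp
  define \<alpha> where "\<alpha> = alpha (p (Suc ?k))"
  have \<alpha>: "0 < \<alpha>" "\<alpha> < 1" using alpha_run[OF k] by (auto simp: \<alpha>_def)
  have A_eq: "A (Suc ?k) = A ?k / (1 - \<alpha>)" unfolding \<alpha>_def by (rule A_Suc[OF k])
  have Bk: "B \<le> psi (A ?k)" using Suc by (smt (verit) divide_nonneg_nonneg of_nat_0_le_iff)
  then have psi: "0 < psi (A ?k)" "max B (psi (A ?k)) = psi (A ?k)" using B_ge_1 by auto
  then have "1 / (2 * psi (A ?k)) \<le> \<alpha>" using alpha_run_ge[OF k] by (simp add: \<alpha>_def)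
  then have "1 / 2 \<le> \<alpha> * psi (A ?k)" using psi(1) by (simp add: field_simps)
  then have "psi (A ?k) + 1 / 6 \<le> (1 + \<alpha> / 3) * psi (A ?k)" by (simp add: algebra_simps)
  also have "\<dots> \<le> psi (A (Suc ?k))"
    unfolding A_eq by (intro psi_gain less_imp_le[OF A_pos[OF k]] \<alpha>)
  finally show ?case using Suc by (simp add: add_divide_distrib)
qed

section \<open>Complexity\<close>

lemma gap_le: "1 \<le> k \<Longrightarrow> f (w k) - f xs \<le> R\<^sup>2 / (2 * A k)"
  by (rule npe_inv_gap[OF run_inv])

lemma rejections_start:
  "int (r 0) \<le> \<lceil>log 2 (Max {1, 4 * \<delta> / \<tau>0, 2 * sqrt (gen_L g M0 M1 x0 * norm (g x0)) / \<tau>0,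
                  div_ext (2 * norm (g x0)) (\<rho> * ereal \<tau>0)})\<rceil>" (is "_ \<le> \<lceil>log 2 ?T\<rceil>")
proof (rule doublings_le)
  show "1 \<le> ?T" by (intro Max_ge) auto
  assume r0: "r 0 \<noteq> 0"
  have "MSBacktrack d g H x0 \<tau>0 (w 1) (\<tau> 1) (r 0)" using run by (simp add: A_NPE_run_def)
  from MSBacktrack_D[OF this] r0
  have rej: "\<nexists>s. accepts d g (H x0) x0 (2 ^ (r 0 - 1) * \<tau>0) s" by auto
  show "2 ^ (r 0 - 1) < ?T"
  proof (rule ccontr)
    assume "\<not> 2 ^ (r 0 - 1) < ?T"
    then have T: "?T \<le> 2 ^ (r 0 - 1)" by (rule leI)
    let ?t = "2 ^ (r 0 - 1) * \<tau>0"
    let ?L = "gen_L g M0 M1 x0 * norm (g x0)"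
    have t: "0 < ?t" using \<tau>0 by simp
    have "4 * \<delta> / \<tau>0 \<le> 2 ^ (r 0 - 1)" using T by simp
    then have 1: "4 * \<delta> \<le> ?t" using \<tau>0 by (simp add: field_simps)
    have "2 * sqrt ?L / \<tau>0 \<le> 2 ^ (r 0 - 1)" using T by simp
    then have "2 * sqrt ?L \<le> ?t" using \<tau>0 by (simp add: field_simps)
    moreover have L: "0 \<le> ?L" using M0 M1 by (simp add: gen_L_def)
    ultimately have "(2 * sqrt ?L)\<^sup>2 \<le> ?t\<^sup>2" by (intro power_mono) auto
    then have 2: "4 * ?L \<le> ?t\<^sup>2" using L by (simp add: power_mult_distrib)
    have 3: "ereal (2 * norm (g x0) / ?t) \<le> \<rho>"
    proof (cases \<rho>)
      case (real q)
      have q: "0 < q" using \<rho> real by simp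
      have "div_ext (2 * norm (g x0)) (\<rho> * ereal \<tau>0) = 2 * norm (g x0) / (q * \<tau>0)"
        unfolding real using q \<tau>0 by (simp add: div_ext_def)
      then have "2 * norm (g x0) / (q * \<tau>0) \<le> 2 ^ (r 0 - 1)" using T by simp
      then have "2 * norm (g x0) / ?t \<le> q" using q \<tau>0 by (simp add: field_simps)
      then show ?thesis using real by simp
    qed (use \<rho> in auto)
    show False using start_accepts[OF t 1 2 3] rej by blast
  qed
qed

lemma p_eq: "1 \<le> N \<Longrightarrow> p N = 2 ^ (\<Sum>k=1..<N. r k)"
proof (induction N rule: nat_induct_at_least)
  case base
  show ?case using p_1 by simp
next
  case (Suc k)
  then show ?case using p_Suc[OF Suc.hyps] by (simp add: power_add)
qed

lemma psi_eps:
  assumes "0 < \<epsilon>"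
  shows "psi (R\<^sup>2 / (2 * \<epsilon>)) = max (root 3 (20 * M0 * R ^ 3 / \<epsilon>)) (sqrt (4 * \<delta> * R\<^sup>2 / \<epsilon>))"
proof -
  have "40 * M0 * R * (R\<^sup>2 / (2 * \<epsilon>)) = 20 * M0 * R ^ 3 / \<epsilon>"
    by (simp add: power2_eq_square power3_eq_cube field_simps)
  moreover have "8 * \<delta> * (R\<^sup>2 / (2 * \<epsilon>)) = 4 * \<delta> * R\<^sup>2 / \<epsilon>" by simp
  ultimately show ?thesis by (simp only: psi_def)
qed

lemma rejections_le:
  assumes N: "1 \<le> N" and \<epsilon>: "0 < \<epsilon>" and bd: "\<And>k. 1 \<le> k \<Longrightarrow> k < N \<Longrightarrow> A k \<le> R\<^sup>2 / (2 * \<epsilon>)"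
  shows "int (\<Sum>k<N. r k) \<le> rejection_bound g x0 \<tau>0 M0 M1 \<delta> R \<rho> \<epsilon>"
proof -
  define x where "x = 20 * M0 * R ^ 3 / \<epsilon>"
  define y where "y = 4 * \<delta> * R\<^sup>2 / \<epsilon>"
  have xy: "0 \<le> x" "0 \<le> y" using M0 R_pos \<delta>_nonneg \<epsilon> by (auto simp: x_def y_def)
  define T where "T = Max {B\<^sup>2, y, x powr (2 / 3)}"
  have T: "B\<^sup>2 \<le> T" "y \<le> T" "(root 3 x)\<^sup>2 \<le> T" unfolding T_def root3_powr[OF xy(1)] by simp_all
  have T1: "1 \<le> T" using T(1) B_ge_1 by (meson one_le_power order_trans)
  define \<Theta> where "\<Theta> = sqrt T"
  have \<Theta>2: "\<Theta>\<^sup>2 = T" using T1 by (simp add: \<Theta>_def)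
  have B\<Theta>: "B \<le> \<Theta>" unfolding \<Theta>_def using T(1) by (rule real_le_rsqrt)
  have "root 3 x \<le> \<Theta>" unfolding \<Theta>_def using T(3) by (rule real_le_rsqrt)
  moreover have "sqrt y \<le> \<Theta>" unfolding \<Theta>_def using T(2) by simp
  ultimately have psi\<Theta>: "psi (R\<^sup>2 / (2 * \<epsilon>)) \<le> \<Theta>" unfolding psi_eps[OF \<epsilon>] x_def y_def by simp
  have "p N = 1 \<or> p N < 2 * \<Theta>\<^sup>2"
    using bd psi_mono psi\<Theta> by (intro p_after_rejections N B\<Theta>) (meson order_trans)
  then have pN: "p N = 1 \<or> p N < 2 * T" unfolding \<Theta>2 .
  have "int (\<Sum>k=1..<N. r k) \<le> \<lceil>log 2 T\<rceil>"
  proof (rule doublings_le[OF T1])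
    assume "(\<Sum>k=1..<N. r k) \<noteq> 0"
    then obtain j where j: "(\<Sum>k=1..<N. r k) = Suc j" by (cases "\<Sum>k=1..<N. r k") auto
    then have "p N = 2 * 2 ^ j" using p_eq[OF N] by simp
    moreover have "(1::real) \<le> 2 ^ j" by simp
    ultimately have "2 ^ j < T" using pN by linarith
    then show "2 ^ ((\<Sum>k=1..<N. r k) - 1) < T" by (simp only: j diff_Suc_1)
  qed
  moreover have "(\<Sum>k<N. r k) = r 0 + (\<Sum>k=1..<N. r k)"
    using N by (simp add: lessThan_atLeast0 sum.atLeast_Suc_lessThan)
  ultimately show ?thesis
    using rejections_start by (simp add: rejection_bound_def T_def x_def y_def B_def)
qed

lemma eps_tr_nonneg: "0 \<le> eps_tr M0 \<delta> R B"
  using M0 R_pos B_ge_1 by (simp add: eps_tr_def le_max_iff_disj)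

lemma phase1_length:
  assumes k: "1 \<le> k" and psi: "psi (A k) \<le> B" and \<epsilon>: "2 * A k * \<epsilon> \<le> R\<^sup>2" "0 < \<epsilon>"
  shows "real k - 1 \<le> 2 * B * ln (R\<^sup>2 / (2 * A 1 * \<epsilon>))"
proof -
  have A: "0 < A 1" using A_pos by simp
  have "A 1 * exp ((real k - 1) / (2 * B)) \<le> A k"
  proof (rule A_exponential[OF k])
    fix i assume "1 \<le> i" "i < k"
    then have "psi (A i) \<le> psi (A k)" by (intro psi_mono A_mono) auto
    then show "psi (A i) \<le> B" using psi by simp
  qed
  also have "A k \<le> R\<^sup>2 / (2 * \<epsilon>)" using \<epsilon> by (simp add: field_simps)
  finally have "exp ((real k - 1) / (2 * B)) \<le> R\<^sup>2 / (2 * A 1 * \<epsilon>)" using A \<epsilon>(2) by (simp add: field_simps)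
  moreover have "0 < R\<^sup>2 / (2 * A 1 * \<epsilon>)" using A \<epsilon>(2) R_pos by simp
  ultimately have "(real k - 1) / (2 * B) \<le> ln (R\<^sup>2 / (2 * A 1 * \<epsilon>))" by (simp add: ln_ge_iff)
  then show ?thesis using B_ge_1 by (simp add: field_simps)
qed

text \<open>The iterations up to \<open>k\<close> split at the first index \<open>m\<close> with \<open>psi (A m) \<ge> B\<close>. Before \<open>m\<close> the weights grow exponentially and are
  at most \<open>R\<^sup>2 / (2 max \<epsilon> \<epsilon>\<^sub>t\<^sub>r)\<close>; after \<open>m\<close>, \<open>psi\<close> grows linearly and is at most \<open>psi (R\<^sup>2 / (2 \<epsilon>))\<close>.\<close>

lemma iterations_le:
  assumes k: "1 \<le> k" and \<epsilon>: "0 < \<epsilon>" and Ak: "2 * A k * \<epsilon> \<le> R\<^sup>2"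
  shows "real k + 1 \<le> iteration_bound M0 M1 \<delta> R \<rho> (A 1) 4320 \<epsilon>"
proof -
  define \<epsilon>' where "\<epsilon>' = max \<epsilon> (eps_tr M0 \<delta> R B)"
  define l where "l = log_plus (R\<^sup>2 / (2 * A 1 * \<epsilon>'))"
  have \<epsilon>': "0 < \<epsilon>'" using \<epsilon> by (simp add: \<epsilon>'_def)
  have "0 \<le> l" by (simp add: l_def log_plus_def)
  then have Bl: "0 \<le> B * l" using B_ge_1 by simp
  define X where "X = (M0 * R ^ 3 / \<epsilon>) powr (1 / 3)"
  define Y where "Y = sqrt (\<delta> * R\<^sup>2 / \<epsilon>)"
  have X: "X = root 3 (M0 * R ^ 3 / \<epsilon>)" "0 \<le> X" and Y0: "0 \<le> Y"
    using M0 R_pos \<delta>_nonneg \<epsilon> by (auto simp: X_def Y_def root3_powr)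
  have phase1: "real i - 1 \<le> 2 * (B * l)" if i: "1 \<le> i" "psi (A i) \<le> B" "2 * A i * \<epsilon> \<le> R\<^sup>2" for i
  proof -
    have "2 * A i * eps_tr M0 \<delta> R B \<le> R\<^sup>2"
      using i psi_le_B_iff less_imp_le[OF A_pos[OF i(1)]] by blast
    then have "2 * A i * \<epsilon>' \<le> R\<^sup>2" using i(3) by (simp add: \<epsilon>'_def max_def)
    from phase1_length[OF i(1,2) this \<epsilon>']
    have "real i - 1 \<le> 2 * B * ln (R\<^sup>2 / (2 * A 1 * \<epsilon>'))" .
    also have "\<dots> \<le> 2 * B * l" using B_ge_1 by (intro mult_left_mono) (auto simp: l_def log_plus_def)
    finally show ?thesis by simp
  qed
  have "real k + 1 \<le> 3 + 2 * (B * l) + 18 * X + 12 * Y"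
  proof (cases "psi (A k) \<le> B")
    case True
    then show ?thesis using phase1[OF k True Ak] X(2) Y0 by simp
  next
    case False
    define m where "m = (LEAST i. 1 \<le> i \<and> B \<le> psi (A i))"
    have m: "1 \<le> m" "B \<le> psi (A m)" and mk: "m \<le> k"
      using LeastI[of "\<lambda>i. 1 \<le> i \<and> B \<le> psi (A i)" k] Least_le[of "\<lambda>i. 1 \<le> i \<and> B \<le> psi (A i)" k]
        k False by (auto simp: m_def)
    have m_le: "real m \<le> 2 + 2 * (B * l)"
    proof (cases "m = 1")
      case True
      then show ?thesis using Bl by simp
    next
      case False
      then have m1: "1 \<le> m - 1" "m - 1 < m" using m(1) by auto
      have "\<not> B \<le> psi (A (m - 1))"
        using not_less_Least[of "m - 1" "\<lambda>i. 1 \<le> i \<and> B \<le> psi (A i)"] m1 by (simp add: m_def)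
      moreover have "A (m - 1) \<le> A k" using m1 mk by (intro A_mono) auto
      then have "2 * A (m - 1) * \<epsilon> \<le> R\<^sup>2" using Ak \<epsilon> by (smt (verit) mult_right_mono)
      ultimately have "real (m - 1) - 1 \<le> 2 * (B * l)" using m1 by (intro phase1) auto
      then show ?thesis using m(1) by simp
    qed
    have "B + real (k - m) / 6 \<le> psi (A k)" using psi_linear[OF m, of "k - m"] mk by simp
    also have "\<dots> \<le> psi (R\<^sup>2 / (2 * \<epsilon>))" using Ak \<epsilon> by (intro psi_mono) (simp add: field_simps)
    also have "\<dots> \<le> 3 * X + 2 * Y"
    proof -
      have "root 3 (20 * M0 * R ^ 3 / \<epsilon>) \<le> root 3 (3 ^ 3 * (M0 * R ^ 3 / \<epsilon>))"
        using M0 R_pos \<epsilon> by (simp add: field_simps)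
      also have "\<dots> = 3 * X" unfolding real_root_mult X(1) by (simp add: real_root_power_cancel)
      finally have "root 3 (20 * M0 * R ^ 3 / \<epsilon>) \<le> 3 * X" .
      moreover have "sqrt (4 * \<delta> * R\<^sup>2 / \<epsilon>) = 2 * Y"
        unfolding Y_def using real_sqrt_mult[of 4 "\<delta> * R\<^sup>2 / \<epsilon>"] by (simp add: mult.assoc)
      ultimately show ?thesis unfolding psi_eps[OF \<epsilon>] using X(2) Y0 by simp
    qed
    finally have "real (k - m) \<le> 18 * X + 12 * Y" using B_ge_1 by simp
    then show ?thesis using m_le mk by simp
  qed
  also have "\<dots> \<le> 4320 * (B * (1 + l) + X + Y)"
  proof -
    have "4320 * (B * (1 + l) + X + Y) = 4320 * B + 4320 * (B * l) + 4320 * X + 4320 * Y"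
      by (simp add: algebra_simps)
    then show ?thesis using X(2) Y0 B_ge_1 Bl by linarith
  qed
  also have "\<dots> = iteration_bound M0 M1 \<delta> R \<rho> (A 1) 4320 \<epsilon>"
    by (simp add: iteration_bound_def Let_def B_def[symmetric] l_def \<epsilon>'_def X_def Y_def)
  finally show ?thesis .
qed

text \<open>The index \<open>N\<close> is the first at which the weight alone certifies the accuracy \<open>\<epsilon>\<close>. It may come later than the
  first \<open>\<epsilon>\<close>-accurate iterate, but all earlier weights are then bounded, as the rejection count requires.\<close>

lemma complexity:
  assumes \<epsilon>: "0 < \<epsilon>"
  shows "\<exists>N\<ge>1. f (w N) - f xs \<le> \<epsilon> \<and>
             real N \<le> iteration_bound M0 M1 \<delta> R \<rho> (A 1) 4320 \<epsilon> \<and>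
             int (\<Sum>k<N. r k) \<le> rejection_bound g x0 \<tau>0 M0 M1 \<delta> R \<rho> \<epsilon>"
proof -
  let ?bd = "iteration_bound M0 M1 \<delta> R \<rho> (A 1) 4320 \<epsilon>"
  have ex: "\<exists>k\<ge>1. R\<^sup>2 < 2 * A k * \<epsilon>"
  proof (rule ccontr)
    assume n: "\<not> ?thesis"
    obtain k where k: "?bd < real k" using reals_Archimedean2 by blast
    then have "?bd < real (Suc k)" by simp
    moreover have "real (Suc k) + 1 \<le> ?bd" using n by (intro iterations_le \<epsilon>) (auto simp: not_less)
    ultimately show False by simp
  qed
  define N where "N = (LEAST k. 1 \<le> k \<and> R\<^sup>2 < 2 * A k * \<epsilon>)"
  have N: "1 \<le> N" "R\<^sup>2 < 2 * A N * \<epsilon>"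
    using LeastI_ex[of "\<lambda>k. 1 \<le> k \<and> R\<^sup>2 < 2 * A k * \<epsilon>"] ex by (auto simp: N_def)
  have before: "2 * A k * \<epsilon> \<le> R\<^sup>2" if "1 \<le> k" "k < N" for k
    using not_less_Least[of k "\<lambda>k. 1 \<le> k \<and> R\<^sup>2 < 2 * A k * \<epsilon>"] that by (auto simp: N_def not_less)
  have "R\<^sup>2 / (2 * A N) \<le> \<epsilon>" using N A_pos[OF N(1)] by (simp add: field_simps)
  then have "f (w N) - f xs \<le> \<epsilon>" using gap_le[OF N(1)] by linarith
  moreover have "real N \<le> ?bd"
  proof (cases "N = 1")
    case True
    have "0 \<le> log_plus t" for t by (simp add: log_plus_def)
    then have "1 * 1 \<le> B * (1 + log_plus (R\<^sup>2 / (2 * A 1 * max \<epsilon> (eps_tr M0 \<delta> R B))))"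
      using B_ge_1 by (intro mult_mono) (auto simp: add_increasing2)
    moreover have "0 \<le> (M0 * R ^ 3 / \<epsilon>) powr (1 / 3)" "0 \<le> sqrt (\<delta> * R\<^sup>2 / \<epsilon>)"
      using \<delta>_nonneg \<epsilon> by auto
    moreover have "real N \<le> 4320 * (q + x + y)" if "1 * 1 \<le> q" "0 \<le> x" "0 \<le> y" for q x y :: real
      using that True by simp
    ultimately show ?thesis unfolding iteration_bound_def Let_def B_def[symmetric] by blast
  next
    case False
    then have "real (N - 1) + 1 \<le> ?bd" using N(1) by (intro iterations_le \<epsilon> before) auto
    then show ?thesis using N(1) by simp
  qed
  moreover have "int (\<Sum>k<N. r k) \<le> rejection_bound g x0 \<tau>0 M0 M1 \<delta> R \<rho> \<epsilon>"
    using before \<epsilon> by (intro rejections_le N) (auto simp: field_simps)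
  ultimately show ?thesis using N(1) by blast
qed

lemma exponential_gap:
  assumes k: "1 \<le> k" and psi: "\<And>i. 1 \<le> i \<Longrightarrow> i < k \<Longrightarrow> psi (A i) \<le> B"
  shows "f (w k) - f xs \<le> 4320 * (R\<^sup>2 / A 1) * exp (- (1 / 2 * (real k - 1) / B))"
proof -
  let ?e = "exp ((real k - 1) / (2 * B))"
  have A1: "0 < A 1" using A_pos by simp
  have "f (w k) - f xs \<le> R\<^sup>2 / (2 * A k)" by (rule gap_le[OF k])
  also have "\<dots> \<le> R\<^sup>2 / (2 * (A 1 * ?e))"
    using A_exponential[OF k psi] A1 A_pos[OF k] by (intro divide_left_mono mult_pos_pos) auto
  also have "\<dots> = 1 / 2 * (R\<^sup>2 / A 1 * exp (- ((real k - 1) / (2 * B))))"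
    by (simp add: exp_minus divide_simps)
  also have "\<dots> \<le> 4320 * (R\<^sup>2 / A 1 * exp (- ((real k - 1) / (2 * B))))"
    using A1 by (intro mult_right_mono) auto
  finally show ?thesis by (simp add: mult.assoc)
qed

lemma polynomial_gap:
  assumes m: "1 \<le> m" and B: "B \<le> psi (A m)"
  shows "f (w (m + n)) - f xs
     \<le> 4320 * (M0 * R ^ 3 / (B + real n) ^ 3 + \<delta> * R\<^sup>2 / (B + real n)\<^sup>2)"
proof -
  define b where "b = B + real n"
  define a where "a = A (m + n)"
  have b: "0 < b" using B_ge_1 by (simp add: b_def)
  have a: "0 < a" using A_pos m by (simp add: a_def)
  have nonneg: "0 \<le> M0 * R ^ 3 / b ^ 3" "0 \<le> \<delta> * R\<^sup>2 / b\<^sup>2"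
    using M0 R_pos \<delta>_nonneg b by auto
  have "b / 6 \<le> B + real n / 6" using B_ge_1 by (simp add: b_def)
  also have "\<dots> \<le> psi a" unfolding a_def by (rule psi_linear[OF m B])
  finally have "b / 6 \<le> root 3 (40 * M0 * R * a) \<or> b / 6 \<le> sqrt (8 * \<delta> * a)"
    by (auto simp: psi_def le_max_iff_disj)
  then have "R\<^sup>2 / (2 * a) \<le> 4320 * (M0 * R ^ 3 / b ^ 3) \<or> R\<^sup>2 / (2 * a) \<le> 144 * (\<delta> * R\<^sup>2 / b\<^sup>2)"
  proof (elim disj_forward)
    assume "b / 6 \<le> root 3 (40 * M0 * R * a)"
    then have "(b / 6) ^ 3 \<le> (root 3 (40 * M0 * R * a)) ^ 3" using b by (intro power_mono) auto
    also have "\<dots> = 40 * M0 * R * a" using M0 R_pos a by simp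
    finally have "b ^ 3 \<le> 8640 * M0 * R * a" by (simp add: power_divide)
    then have "R\<^sup>2 * b ^ 3 \<le> R\<^sup>2 * (8640 * M0 * R * a)" by (intro mult_left_mono) auto
    then show "R\<^sup>2 / (2 * a) \<le> 4320 * (M0 * R ^ 3 / b ^ 3)"
      using a b by (simp add: divide_simps power2_eq_square power3_eq_cube mult_ac)
  next
    assume "b / 6 \<le> sqrt (8 * \<delta> * a)"
    then have "(b / 6)\<^sup>2 \<le> (sqrt (8 * \<delta> * a))\<^sup>2" using b by (intro power_mono) auto
    also have "\<dots> = 8 * \<delta> * a" using \<delta>_nonneg a by simp
    finally have "b\<^sup>2 \<le> 288 * \<delta> * a" by (simp add: power_divide)
    then have "R\<^sup>2 * b\<^sup>2 \<le> R\<^sup>2 * (288 * \<delta> * a)" by (intro mult_left_mono) auto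
    then show "R\<^sup>2 / (2 * a) \<le> 144 * (\<delta> * R\<^sup>2 / b\<^sup>2)"
      using a b by (simp add: divide_simps mult_ac)
  qed
  moreover have "f (w (m + n)) - f xs \<le> R\<^sup>2 / (2 * a)"
    unfolding a_def using m by (intro gap_le) auto
  ultimately show ?thesis unfolding b_def[symmetric] using nonneg by (simp add: distrib_left) linarith
qed

text \<open>\<open>K\<close> is the first index at which \<open>psi (A k)\<close> reaches \<open>B\<close>. If there is none, the exponential growth
  of the weights under the bound \<open>2 A \<epsilon>\<^sub>t\<^sub>r \<le> R\<^sup>2\<close> forces \<open>\<epsilon>\<^sub>t\<^sub>r = 0\<close>.\<close>

lemma two_phases:
  defines "\<epsilon>tr \<equiv> eps_tr M0 \<delta> R B"
  shows "\<exists>K :: enat. K \<ge> 1 \<and>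
             (K = \<infinity> \<longrightarrow> \<epsilon>tr = 0) \<and>
             (\<forall>m. K = enat m \<and> \<epsilon>tr > 0 \<longrightarrow>
                real m \<le> 4320 * B * max 1 (ln (R\<^sup>2 / (2 * A 1 * \<epsilon>tr)))) \<and>
             (\<forall>k\<ge>1. enat k \<le> K \<longrightarrow>
                f (w k) - f xs \<le> 4320 * (R\<^sup>2 / A 1) * exp (- (1 / 2 * (real k - 1) / B))) \<and>
             (\<forall>m n. K = enat m \<longrightarrow>
                f (w (m + n)) - f xs
                  \<le> 4320 * (M0 * R ^ 3 / (B + real n) ^ 3 + \<delta> * R\<^sup>2 / (B + real n)\<^sup>2))"
proof (cases "\<exists>k\<ge>1. B \<le> psi (A k)")
  case False
  then have psi: "psi (A k) \<le> B" if "1 \<le> k" for k using that by (meson linear)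
  have "\<epsilon>tr = 0"
  proof (rule ccontr)
    assume "\<epsilon>tr \<noteq> 0"
    then have pos: "0 < \<epsilon>tr" using eps_tr_nonneg by (simp add: \<epsilon>tr_def)
    obtain k where k: "2 * B * ln (R\<^sup>2 / (2 * A 1 * \<epsilon>tr)) < real k" using reals_Archimedean2 by blast
    have "2 * A (Suc k) * \<epsilon>tr \<le> R\<^sup>2"
      using psi[of "Suc k"] psi_le_B_iff[of "A (Suc k)"] A_pos[of "Suc k"] by (simp add: \<epsilon>tr_def)
    then have "real (Suc k) - 1 \<le> 2 * B * ln (R\<^sup>2 / (2 * A 1 * \<epsilon>tr))"
      by (intro phase1_length psi pos) auto
    then show False using k by simp
  qed
  then show ?thesis using psi exponential_gap by (intro exI[of _ \<infinity>]) auto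
next
  case True
  define m where "m = (LEAST k. 1 \<le> k \<and> B \<le> psi (A k))"
  have m: "1 \<le> m" "B \<le> psi (A m)"
    using LeastI_ex[of "\<lambda>k. 1 \<le> k \<and> B \<le> psi (A k)"] True by (auto simp: m_def)
  have psi: "psi (A k) \<le> B" if "1 \<le> k" "k < m" for k
    using not_less_Least[of k "\<lambda>k. 1 \<le> k \<and> B \<le> psi (A k)"] that by (auto simp: m_def)
  have len: "real m \<le> 4320 * B * max 1 (ln (R\<^sup>2 / (2 * A 1 * \<epsilon>tr)))" if pos: "0 < \<epsilon>tr"
  proof -
    define l where "l = max 1 (ln (R\<^sup>2 / (2 * A 1 * \<epsilon>tr)))"
    have "1 * 1 \<le> B * l" using B_ge_1 by (intro mult_mono) (auto simp: l_def)
    have "real m \<le> 2 + 2 * (B * l)"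
    proof (cases "m = 1")
      case True
      then show ?thesis using \<open>1 * 1 \<le> B * l\<close> by simp
    next
      case False
      then have m1: "1 \<le> m - 1" "m - 1 < m" using m(1) by auto
      have "2 * A (m - 1) * \<epsilon>tr \<le> R\<^sup>2"
        using psi[OF m1] psi_le_B_iff[of "A (m - 1)"] A_pos[OF m1(1)] by (simp add: \<epsilon>tr_def)
      then have "real (m - 1) - 1 \<le> 2 * B * ln (R\<^sup>2 / (2 * A 1 * \<epsilon>tr))"
        by (intro phase1_length psi m1 pos) auto
      also have "\<dots> \<le> 2 * B * l" using B_ge_1 by (intro mult_left_mono) (auto simp: l_def)
      finally show ?thesis using m(1) by simp
    qed
    then show ?thesis using \<open>1 * 1 \<le> B * l\<close> by (simp add: l_def)
  qed
  have "f (w k) - f xs \<le> 4320 * (R\<^sup>2 / A 1) * exp (- (1 / 2 * (real k - 1) / B))"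
    if "1 \<le> k" "k \<le> m" for k
    using that psi by (intro exponential_gap) auto
  then show ?thesis
    using len m polynomial_gap[OF m] by (intro exI[of _ "enat m"]) (auto simp: one_enat_def)
qed

end

section \<open>The complexity theorem\<close>

theorem theoremE1:
  shows "\<exists>C c :: real. C > 0 \<and> c > 0 \<and>
    (\<forall>(d :: nat) (f :: rvec \<Rightarrow> real) (g :: rvec \<Rightarrow> rvec) (D :: rvec \<Rightarrow> (rvec \<Rightarrow>\<^sub>L rvec))
       (H :: rvec \<Rightarrow> (rvec \<Rightarrow>\<^sub>L rvec)) (\<delta> :: real) (M0 :: real) (M1 :: real) (\<rho> :: ereal)
       (xs :: rvec) (x0 :: rvec) (\<tau>0 :: real).
      convex_on (Rd d) f \<and> C2_on_Rd d f g D \<and>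
      xs \<in> Rd d \<and> (\<forall>x\<in>Rd d. f xs \<le> f x) \<and>
      (\<forall>x\<in>Rd d. H x \<in> sym_mats d \<and> norm (H x - D x) \<le> \<delta>) \<and>
      M0 \<ge> 0 \<and> M1 \<ge> 0 \<and>
      ((\<rho> = \<infinity> \<and> hess_smooth_global d g D M0 M1) \<or>
       (\<exists>r>0. \<rho> = ereal r \<and> hess_smooth_local d g D M0 M1 r)) \<and>
      x0 \<in> Rd d \<and> x0 \<noteq> xs \<and> \<tau>0 > 0
      \<longrightarrow>
      (\<exists>w z A \<tau> r. A_NPE_run d g H x0 \<tau>0 w z A \<tau> r) \<and>
      (\<forall>w z A \<tau> r. A_NPE_run d g H x0 \<tau>0 w z A \<tau> r \<longrightarrow>
        (let R = norm (x0 - xs); B = B_const M1 R \<rho>; \<epsilon>tr = eps_tr M0 \<delta> R B in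
          (\<forall>\<epsilon>>0. \<exists>N\<ge>1. f (w N) - f xs \<le> \<epsilon> \<and>
             real N \<le> iteration_bound M0 M1 \<delta> R \<rho> (A 1) C \<epsilon> \<and>
             int (\<Sum>k<N. r k) \<le> rejection_bound g x0 \<tau>0 M0 M1 \<delta> R \<rho> \<epsilon>) \<and>
          (\<exists>K :: enat. K \<ge> 1 \<and>
             (K = \<infinity> \<longrightarrow> \<epsilon>tr = 0) \<and>
             (\<forall>m. K = enat m \<and> \<epsilon>tr > 0 \<longrightarrow>
                real m \<le> C * B * max 1 (ln (R\<^sup>2 / (2 * A 1 * \<epsilon>tr)))) \<and>
             (\<forall>k\<ge>1. enat k \<le> K \<longrightarrow>
                f (w k) - f xs \<le> C * (R\<^sup>2 / A 1) * exp (- (c * (real k - 1) / B))) \<and>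
             (\<forall>m n. K = enat m \<longrightarrow>
                f (w (m + n)) - f xs
                  \<le> C * (M0 * R ^ 3 / (B + real n) ^ 3 + \<delta> * R\<^sup>2 / (B + real n)\<^sup>2)))))) "
proof -
  have concl: "(\<exists>w z A \<tau> r. A_NPE_run d g H x0 \<tau>0 w z A \<tau> r) \<and>
      (\<forall>w z A \<tau> r. A_NPE_run d g H x0 \<tau>0 w z A \<tau> r \<longrightarrow>
        (let R = norm (x0 - xs); B = B_const M1 R \<rho>; \<epsilon>tr = eps_tr M0 \<delta> R B in
          (\<forall>\<epsilon>>0. \<exists>N\<ge>1. f (w N) - f xs \<le> \<epsilon> \<and>
             real N \<le> iteration_bound M0 M1 \<delta> R \<rho> (A 1) 4320 \<epsilon> \<and>
             int (\<Sum>k<N. r k) \<le> rejection_bound g x0 \<tau>0 M0 M1 \<delta> R \<rho> \<epsilon>) \<and>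
          (\<exists>K :: enat. K \<ge> 1 \<and>
             (K = \<infinity> \<longrightarrow> \<epsilon>tr = 0) \<and>
             (\<forall>m. K = enat m \<and> \<epsilon>tr > 0 \<longrightarrow>
                real m \<le> 4320 * B * max 1 (ln (R\<^sup>2 / (2 * A 1 * \<epsilon>tr)))) \<and>
             (\<forall>k\<ge>1. enat k \<le> K \<longrightarrow>
                f (w k) - f xs \<le> 4320 * (R\<^sup>2 / A 1) * exp (- (1 / 2 * (real k - 1) / B))) \<and>
             (\<forall>m n. K = enat m \<longrightarrow>
                f (w (m + n)) - f xs
                  \<le> 4320 * (M0 * R ^ 3 / (B + real n) ^ 3 + \<delta> * R\<^sup>2 / (B + real n)\<^sup>2)))))"
    if asm: "convex_on (Rd d) f \<and> C2_on_Rd d f g D \<and>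
      xs \<in> Rd d \<and> (\<forall>x\<in>Rd d. f xs \<le> f x) \<and>
      (\<forall>x\<in>Rd d. H x \<in> sym_mats d \<and> norm (H x - D x) \<le> \<delta>) \<and>
      M0 \<ge> 0 \<and> M1 \<ge> 0 \<and>
      ((\<rho> = \<infinity> \<and> hess_smooth_global d g D M0 M1) \<or>
       (\<exists>r>0. \<rho> = ereal r \<and> hess_smooth_local d g D M0 M1 r)) \<and>
      x0 \<in> Rd d \<and> x0 \<noteq> xs \<and> \<tau>0 > 0"
    for d f g D H \<delta> M0 M1 \<rho> xs x0 \<tau>0
  proof -
    interpret npe_problem d f g D H \<delta> M0 M1 \<rho> xs x0
      by unfold_locales (use asm in \<open>auto simp: hess_smooth_global_def hess_smooth_local_def\<close>)
    have \<tau>0: "0 < \<tau>0" using asm by blast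
    show ?thesis
    proof (intro conjI allI impI)
      show "\<exists>w z A \<tau> r. A_NPE_run d g H x0 \<tau>0 w z A \<tau> r" by (rule run_exists[OF \<tau>0])
    next
      fix w z A \<tau> r
      assume "A_NPE_run d g H x0 \<tau>0 w z A \<tau> r"
      then interpret npe_run d f g D H \<delta> M0 M1 \<rho> xs x0 \<tau>0 w z A \<tau> r
        by unfold_locales (use \<tau>0 in auto)
      show "let R = norm (x0 - xs); B = B_const M1 R \<rho>; \<epsilon>tr = eps_tr M0 \<delta> R B in
          (\<forall>\<epsilon>>0. \<exists>N\<ge>1. f (w N) - f xs \<le> \<epsilon> \<and>
             real N \<le> iteration_bound M0 M1 \<delta> R \<rho> (A 1) 4320 \<epsilon> \<and>
             int (\<Sum>k<N. r k) \<le> rejection_bound g x0 \<tau>0 M0 M1 \<delta> R \<rho> \<epsilon>) \<and>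
          (\<exists>K :: enat. K \<ge> 1 \<and>
             (K = \<infinity> \<longrightarrow> \<epsilon>tr = 0) \<and>
             (\<forall>m. K = enat m \<and> \<epsilon>tr > 0 \<longrightarrow>
                real m \<le> 4320 * B * max 1 (ln (R\<^sup>2 / (2 * A 1 * \<epsilon>tr)))) \<and>
             (\<forall>k\<ge>1. enat k \<le> K \<longrightarrow>
                f (w k) - f xs \<le> 4320 * (R\<^sup>2 / A 1) * exp (- (1 / 2 * (real k - 1) / B))) \<and>
             (\<forall>m n. K = enat m \<longrightarrow>
                f (w (m + n)) - f xs
                  \<le> 4320 * (M0 * R ^ 3 / (B + real n) ^ 3 + \<delta> * R\<^sup>2 / (B + real n)\<^sup>2)))"
        unfolding Let_def R_def[symmetric] B_def[symmetric]
        using complexity two_phases by blast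
    qed
  qed
  show ?thesis
    by (rule exI[of _ 4320], rule exI[of _ "1 / 2"], rule conjI, simp, rule conjI, simp,
        intro allI impI, rule concl)
qed

end
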